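(* Let $T>0$, $\beta\in(\frac12,1]$, $\alpha\in(\frac12,\beta)$, let $\mathcal V,\mathcal W,\mathcal X$ be Banach spaces, $g\in C^\beta([0,T],\mathcal V)$, $w\in C^\alpha([0,T],\mathcal W)$, and let $\sigma\colon\mathbb R\times\mathcal W\times\mathcal X\to\mathcal L(\mathcal V,\mathcal X)$ be an $\alpha$-nice function (see context). Then for any $0\le\underline t<\overline t\le T$ the Young differential equation $$dx_t=\sigma(t,w_t,x_t)\,dg_t\quad\text{with initial condition } x_{\underline t}=a\in\mathcal X\qquad(\ast)$$ (i) has a unique solution $x$ with $x\in C^\alpha([\underline t,\overline t],\mathcal X)$. Moreover, for any $R>0$ there exist constants $C^R_{\rm flow},C^R_{\rm flow,loc},C^R_{\rm init},C^R_{\rm driver},C^R_{\rm param}>0$ such that for all initial conditions $a,b\in B(0,R)\subset\mathcal X$, all driving signals $g,\tilde g\in C^\beta([0,T],\mathcal V)$ with $[g]_\beta,[\tilde g]_\beta\le R$, all $w,\tilde w\in C^\alpha([0,T],\mathcal W)$ with $\|w\|_\alpha,\|\tilde w\|_\alpha\le R$, and all $0\le\underline t<\overline t\le T$: (ii) (Local flow bound) With $\psi(a;\underline t,\cdot)$ the flow (solution path) of $(\ast)$ starting at $a$ at time $\underline t$, $$\|\psi(a;\underline t,\cdot)\|_\alpha\le C^R_{\rm flow},\qquad[\psi(a;\underline t,\cdot)]_{\alpha,[\underline t,\overline t]}\le C^R_{\rm flow,loc}\,|\overline t-\underline t|^{\beta-\alpha}.$$ (iii) (Local Lipschitz continuity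 in the initial condition) If $x$ and $y$ are the solutions of $(\ast)$ with initial conditions $a$ and $b$ respectively and the same driving signal $g$ and parameters $w$, then $\|x-y\|_{\alpha,[\underline t,\overline t]}\le C^R_{\rm init}|a-b|$. (iv) (Local Lipschitz continuity in the driving signal) If $x$ and $y$ are the solutions of $(\ast)$ with driving signals $g$ and $\tilde g$ respectively and the same initial condition $a$ and parameters $w$, then $\|x-y\|_{\alpha,[\underline t,\overline t]}\le C^R_{\rm driver}[g-\tilde g]_\beta$. If in addition $\sigma$ satisfies the optional condition (d) of the context, then also: (v) (Local Lipschitz continuity in the parameters) If $x$ and $y$ are the solutions of $(\ast)$ with parameters $w$ and $\tilde w$ respectively and the same initial condition $a$ and driving signal $g$, then $\|x-y\|_{\alpha,[\underline t,\overline t]}\le C^R_{\rm param}\|w-\tilde w\|_\alpha$.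
   Context: **Norms.** $|\cdot|$ denotes norms of vectors in Banach spaces (operator norm on $\mathcal L(\cdot,\cdot)$, the bounded linear operators); $B(0,R)$ is the ball of radius $R$. For a Banach-space-valued $f$ on an interval $I$ and $\alpha\in(0,1]$, on a subinterval $J$: $[f]_{\alpha,J}=\sup_{s\ne t\in J}\frac{|f_t-f_s|}{|t-s|^\alpha}$, $\|f\|_{\infty,J}=\sup_{s\in J}|f_s|$, $\|f\|_{\alpha,J}=\|f\|_{\infty,J}+[f]_{\alpha,J}$; omitting $J$ means $J=I$ (the full domain). $C^\alpha(I,\mathcal E)$ is the space of $f\colon I\to\mathcal E$ with $\|f\|_\alpha<\infty$. **$\alpha$-nice function.** $\sigma\colon\mathbb R\times\mathcal W\times\mathcal X\to\mathcal L(\mathcal V,\mathcal X)$ is $\alpha$-nice if: (a) $\|\sigma\|_\infty<\infty$; (b) $\sigma$ is Fréchet differentiable in $x$, and there is a continuous $c\colon\mathbb R^3\to[0,\infty)$ such that both $F=\sigma$ and $F=D_x\sigma$ satisfy $|F(t,w,x)-F(t,\tilde w,\tilde x)|\le c(t,|w|,|\tilde w|)\bigl(|x-\tilde x|+(1+|x|+|\tilde x|)|w-\tilde w|\bigr)$; (c) there is a continuous $\mathsf c\colon\mathbb R\to[0,\infty)$ such that both $F=\sigma$ and $F=D_x\sigma$ satisfy $|F(t,w,x)-F(s,w,x)|\le\mathsf c(|w|)(1+|x|)|t-s|^\alpha$. **Optional condition (d).** $\sigma$ is Fréchet differentiable in $w$ and there are continuous $\tilde c\colon\mathbb R^5\to[0,\infty)$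 and $\tilde{\mathsf c}\colon\mathbb R^2\to[0,\infty)$ with $|D_w\sigma(t,w,x)-D_w\sigma(t,\tilde w,\tilde x)|\le\tilde c(t,|w|,|\tilde w|,|x|,|\tilde x|)\bigl(|x-\tilde x|+|w-\tilde w|\bigr)$ and $|D_w\sigma(t,w,x)-D_w\sigma(s,w,x)|\le\tilde{\mathsf c}(|w|,|x|)|t-s|^\alpha$. **Solution.** A path $x\in C^\alpha([\underline t,\overline t],\mathcal X)$ solves $(\ast)$ if $x_t=a+\int_{\underline t}^t\sigma(s,w_s,x_s)\,dg_s$ for all $t\in[\underline t,\overline t]$, with the Young integral $\int_{\underline t}^t\sigma(s,w_s,x_s)\,dg_s=\lim_{|\pi|\to0}\sum_{[u,v]\in\pi}\sigma(u,w_u,x_u)(g_v-g_u)$ over partitions $\pi$ of $[\underline t,t]$ with mesh $|\pi|\to 0$. **Flow.** $\psi(a;s,t)=x^{s,a}_t$ for $0\le s\le t\le T$, where $x^{s,a}$ is the unique solution on $[s,T]$ of the equation started from $a$ at time $s$; thus $\psi(a;s,\cdot)$ is a path on $[s,T]$. The constants in the theorem may depend on $R$ (and on $\sigma,\alpha,\beta,T$), but not on $a,b,g,\tilde g,w,\tilde w,\underline t,\overline t$. *)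

theory Defs
  imports "HOL-Analysis.Analysis"
begin

text \<open>
  A path on an interval \<open>J\<close> is a total function on the reals of which only the restriction
  to \<open>J\<close> matters. Hoelder (semi)norms take values in \<open>ennreal\<close>, so that they are
  meaningful (possibly infinite) for every function; the supremum over the empty set is \<open>0\<close>.
\<close>

definition holder_seminorm :: "real \<Rightarrow> real set \<Rightarrow> (real \<Rightarrow> 'e::real_normed_vector) \<Rightarrow> ennreal" where
  "holder_seminorm \<alpha> J f =
     (SUP (s, t) \<in> {(s, t). s \<in> J \<and> t \<in> J \<and> s \<noteq> t}. ennreal (norm (f t - f s) / \<bar>t - s\<bar> powr \<alpha>))"

definition sup_norm_on :: "real set \<Rightarrow> (real \<Rightarrow> 'e::real_normed_vector) \<Rightarrow> ennreal" where
  "sup_norm_on J f = (SUP s \<in> J. ennreal (norm (f s)))"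

definition holder_norm :: "real \<Rightarrow> real set \<Rightarrow> (real \<Rightarrow> 'e::real_normed_vector) \<Rightarrow> ennreal" where
  "holder_norm \<alpha> J f = sup_norm_on J f + holder_seminorm \<alpha> J f"

definition holder_space :: "real \<Rightarrow> real set \<Rightarrow> (real \<Rightarrow> 'e::real_normed_vector) set" where
  "holder_space \<alpha> J = {f. holder_norm \<alpha> J f < \<infinity>}"


definition state_param_lipschitz ::
  "(real \<times> real \<times> real \<Rightarrow> real) \<Rightarrow>
   (real \<Rightarrow> 'w::real_normed_vector \<Rightarrow> 'x::real_normed_vector \<Rightarrow> 'e::real_normed_vector) \<Rightarrow> bool" where
  "state_param_lipschitz c F \<longleftrightarrow>
     (\<forall>t w w' x x'. norm (F t w x - F t w' x')
        \<le> c (t, norm w, norm w') * (norm (x - x') + (1 + norm x + norm x') * norm (w - w')))"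

definition time_holder ::
  "real \<Rightarrow> (real \<Rightarrow> real) \<Rightarrow>
   (real \<Rightarrow> 'w::real_normed_vector \<Rightarrow> 'x::real_normed_vector \<Rightarrow> 'e::real_normed_vector) \<Rightarrow> bool" where
  "time_holder \<alpha> c F \<longleftrightarrow>
     (\<forall>t s w x. norm (F t w x - F s w x) \<le> c (norm w) * (1 + norm x) * \<bar>t - s\<bar> powr \<alpha>)"

text \<open>
  \<open>D\<close> is the partial Frechet derivative of \<open>\<sigma>\<close> in \<open>x\<close>, which is unique; it takes values
  in the bounded linear maps from the state space to the bounded linear maps \<open>'v \<Rightarrow>\<^sub>L 'x\<close>.
\<close>

definition nice_function ::
  "real \<Rightarrow> (real \<Rightarrow> 'w::real_normed_vector \<Rightarrow> 'x::real_normed_vector \<Rightarrow> ('v::real_normed_vector \<Rightarrow>\<^sub>L 'x)) \<Rightarrow> bool" where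
  "nice_function \<alpha> \<sigma> \<longleftrightarrow>
     (\<exists>M. \<forall>t w x. norm (\<sigma> t w x) \<le> M) \<and>
     (\<exists>D :: real \<Rightarrow> 'w \<Rightarrow> 'x \<Rightarrow> ('x \<Rightarrow>\<^sub>L ('v \<Rightarrow>\<^sub>L 'x)).
        (\<forall>t w x. (\<sigma> t w has_derivative blinfun_apply (D t w x)) (at x)) \<and>
        (\<exists>c. continuous_on UNIV c \<and> (\<forall>z. 0 \<le> c z) \<and>
             state_param_lipschitz c \<sigma> \<and> state_param_lipschitz c D) \<and>
        (\<exists>c. continuous_on UNIV c \<and> (\<forall>z. 0 \<le> c z) \<and>
             time_holder \<alpha> c \<sigma> \<and> time_holder \<alpha> c D))"

text \<open>The additional regularity in the parameter \<open>w\<close>, needed for stability in the parameters.\<close>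

definition nice_in_param ::
  "real \<Rightarrow> (real \<Rightarrow> 'w::real_normed_vector \<Rightarrow> 'x::real_normed_vector \<Rightarrow> ('v::real_normed_vector \<Rightarrow>\<^sub>L 'x)) \<Rightarrow> bool" where
  "nice_in_param \<alpha> \<sigma> \<longleftrightarrow>
     (\<exists>D :: real \<Rightarrow> 'w \<Rightarrow> 'x \<Rightarrow> ('w \<Rightarrow>\<^sub>L ('v \<Rightarrow>\<^sub>L 'x)).
        (\<forall>t w x. ((\<lambda>u. \<sigma> t u x) has_derivative blinfun_apply (D t w x)) (at w)) \<and>
        (\<exists>c :: real \<times> real \<times> real \<times> real \<times> real \<Rightarrow> real. continuous_on UNIV c \<and> (\<forall>z. 0 \<le> c z) \<and>
           (\<forall>t w w' x x'. norm (D t w x - D t w' x')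
              \<le> c (t, norm w, norm w', norm x, norm x') * (norm (x - x') + norm (w - w')))) \<and>
        (\<exists>c :: real \<times> real \<Rightarrow> real. continuous_on UNIV c \<and> (\<forall>z. 0 \<le> c z) \<and>
           (\<forall>t s w x. norm (D t w x - D s w x) \<le> c (norm w, norm x) * \<bar>t - s\<bar> powr \<alpha>)))"


text \<open>
  A partition of \<open>[a, b]\<close> into \<open>n\<close> intervals is given by its points \<open>p 0 < \<dots> < p n\<close>.
  For \<open>a = b\<close> the only one has \<open>n = 0\<close>, so the integral over \<open>[a, a]\<close> is \<open>0\<close>.
\<close>

definition interval_partition :: "real \<Rightarrow> real \<Rightarrow> nat \<Rightarrow> (nat \<Rightarrow> real) \<Rightarrow> bool" where
  "interval_partition a b n p \<longleftrightarrow> p 0 = a \<and> p n = b \<and> (\<forall>i<n. p i < p (Suc i))"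

definition has_young_integral ::
  "(real \<Rightarrow> ('v::real_normed_vector \<Rightarrow>\<^sub>L 'x::real_normed_vector)) \<Rightarrow> (real \<Rightarrow> 'v) \<Rightarrow> real \<Rightarrow> real \<Rightarrow> 'x \<Rightarrow> bool" where
  "has_young_integral f g a b I \<longleftrightarrow>
     (\<forall>\<epsilon>>0. \<exists>\<delta>>0. \<forall>n p. interval_partition a b n p \<and> (\<forall>i<n. p (Suc i) - p i < \<delta>) \<longrightarrow>
        norm ((\<Sum>i<n. blinfun_apply (f (p i)) (g (p (Suc i)) - g (p i))) - I) < \<epsilon>)"

definition yde_solution ::
  "real \<Rightarrow> (real \<Rightarrow> 'w \<Rightarrow> 'x \<Rightarrow> ('v::real_normed_vector \<Rightarrow>\<^sub>L 'x::real_normed_vector)) \<Rightarrow>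
   (real \<Rightarrow> 'v) \<Rightarrow> (real \<Rightarrow> 'w) \<Rightarrow> real \<Rightarrow> real \<Rightarrow> 'x \<Rightarrow> (real \<Rightarrow> 'x) \<Rightarrow> bool" where
  "yde_solution \<alpha> \<sigma> g w t0 t1 a x \<longleftrightarrow>
     x \<in> holder_space \<alpha> {t0..t1} \<and>
     (\<forall>t\<in>{t0..t1}. \<exists>I. has_young_integral (\<lambda>s. \<sigma> s (w s) (x s)) g t0 t I \<and> x t = a + I)"

text \<open>
  The value at time \<open>t\<close> of the unique solution on \<open>[s, T]\<close> started from \<open>a\<close> at time \<open>s\<close>,
  for \<open>0 \<le> s \<le> t \<le> T\<close>. The description is of the value and not of the path, since paths
  are determined on \<open>[s, T]\<close> only.
\<close>

definition yde_flow ::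
  "real \<Rightarrow> (real \<Rightarrow> 'w \<Rightarrow> 'x \<Rightarrow> ('v::real_normed_vector \<Rightarrow>\<^sub>L 'x::real_normed_vector)) \<Rightarrow>
   (real \<Rightarrow> 'v) \<Rightarrow> (real \<Rightarrow> 'w) \<Rightarrow> real \<Rightarrow> 'x \<Rightarrow> real \<Rightarrow> real \<Rightarrow> 'x" where
  "yde_flow \<alpha> \<sigma> g w T a s t = (THE y. \<exists>x. yde_solution \<alpha> \<sigma> g w s T a x \<and> y = x t)"

end

theory Submission imports Defs begin

text \<open>
Everything rests on a reformulation of the Young integral that involves no limit. Put
\<open>\<gamma> = \<alpha> + \<beta> > 1\<close> and \<open>A s t = f s (g t - g s)\<close>. For \<open>f\<close> in \<open>C\<^sup>\<alpha>\<close> and \<open>g\<close> in \<open>C\<^sup>\<beta>\<close> the defect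
\<open>A s t - A s u - A u t\<close> is of order \<open>\<bar>t - s\<bar>\<close> to the power \<open>\<gamma>\<close>. The sewing lemma (\<open>sewing_exists\<close>) then yields a path \<open>Y\<close>
whose increments agree with \<open>A\<close> up to that order, and since \<open>\<gamma> > 1\<close> such a path is unique up to a
constant, so \<open>Y\<close> is the integral of \<open>f\<close> against \<open>g\<close>. Moreover a bound of that order with \<^emph>\<open>some\<close>
constant improves to one with the constant \<open>sewing_const \<gamma>\<close> times that of the defect
(\<open>sewn_improve\<close>). Hence \<open>x\<close> solves the differential equation exactly if it has the
right initial value, is Hoelder continuous, and \<open>x t - x s - \<sigma> s (w s) (x s) (g t - g s)\<close> is of order \<open>\<gamma>\<close>
(\<open>yde_solution_iff_sewn_solution\<close>). In this form solutions can be restricted, concatenated and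
passed to the limit without looking at partitions.

The estimates all have one shape. If on an interval a path \<open>y\<close> has Hoelder constant \<open>L\<close> and is bounded
by \<open>m\<close>, then \<open>\<bar>y t - y s\<bar> \<le> \<kappa> (L + m + \<rho>) \<bar>t - s\<bar>\<^sup>\<beta>\<close>. Because \<open>\<alpha> < \<beta>\<close>, on intervals of a length that
depends on \<open>\<kappa>\<close>, \<open>\<alpha>\<close> and \<open>\<beta>\<close> only, this inequality improves the Hoelder constant it starts from, which bounds \<open>y\<close>
there by its initial value; finitely many such intervals cover \<open>[0, T]\<close>. The outcome
(\<open>growth_controlled_global\<close>) bounds \<open>y\<close> by a constant times \<open>\<bar>y a\<bar> + \<rho>\<close>, in \<open>C\<^sup>\<alpha>\<close> and in \<open>C\<^sup>\<beta>\<close>. It is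
applied twice:

\<^item> To a solution, with \<open>\<rho> = 1\<close>. Boundedness of \<open>\<sigma>\<close> makes \<open>\<kappa>\<close> independent of the solution, so there is no
  explosion, and the \<open>C\<^sup>\<beta>\<close> bound is the local flow bound.

\<^item> To the difference of two solutions, with \<open>\<rho>\<close> measuring the distance of the drivers and of the parameters.
  Here \<open>\<kappa>\<close> depends on the a priori bound just obtained. What has to be estimated is the Hoelder
  constant of \<open>\<sigma>(\<cdot>, w, x) - \<sigma>(\<cdot>, w, y)\<close>; as this is a difference of differences, it needs the
  Lipschitz derivative of \<open>\<sigma>\<close> (\<open>four_point_estimate\<close>). The parameter difference
  \<open>\<sigma>(\<cdot>, w, y) - \<sigma>(\<cdot>, w', y)\<close> is treated in the same way with the derivative in \<open>w\<close>.

Uniqueness and the three Lipschitz estimates are instances of the second application. Existence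
on short intervals is Picard iteration, for which the same difference estimate gives the contraction;
the length of these intervals depends on a bound for the initial value, which the first application
provides uniformly, so finitely many steps reach the end of the interval.
\<close>

section \<open>Hoelder bounds on an interval\<close>

text \<open>
A real-valued bound on the Hoelder seminorm. Ordered arguments \<open>s \<le> t\<close> suit partitions, and the
diagonal may be included because \<open>0 powr \<alpha> = 0\<close>.
\<close>

definition holder_bound :: "real \<Rightarrow> real \<Rightarrow> real \<Rightarrow> real \<Rightarrow> (real \<Rightarrow> 'e::real_normed_vector) \<Rightarrow> bool" where
  "holder_bound \<alpha> L a b f \<longleftrightarrow>
     (\<forall>s t. a \<le> s \<longrightarrow> s \<le> t \<longrightarrow> t \<le> b \<longrightarrow> norm (f t - f s) \<le> L * (t - s) powr \<alpha>)"

lemma holder_boundD: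
  "holder_bound \<alpha> L a b f \<Longrightarrow> a \<le> s \<Longrightarrow> s \<le> t \<Longrightarrow> t \<le> b \<Longrightarrow> norm (f t - f s) \<le> L * (t - s) powr \<alpha>"
  by (simp add: holder_bound_def)

lemma holder_bound_mono:
  assumes "holder_bound \<alpha> L a b f" "L \<le> L'" "a \<le> a'" "b' \<le> b"
  shows "holder_bound \<alpha> L' a' b' f"
  unfolding holder_bound_def
proof (intro allI impI)
  fix s t assume "a' \<le> s" "s \<le> t" "t \<le> b'"
  then have "norm (f t - f s) \<le> L * (t - s) powr \<alpha>"
    using assms by (intro holder_boundD[OF assms(1)]) auto
  also have "\<dots> \<le> L' * (t - s) powr \<alpha>"
    using assms by (intro mult_right_mono) auto
  finally show "norm (f t - f s) \<le> L' * (t - s) powr \<alpha>" .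
qed

lemma holder_bound_concat:
  assumes 1: "holder_bound \<alpha> L a u f" and 2: "holder_bound \<alpha> L' u b f" and nn: "0 \<le> L" "0 \<le> L'" "0 \<le> \<alpha>"
  shows "holder_bound \<alpha> (L + L') a b f"
  unfolding holder_bound_def
proof (intro allI impI)
  fix s t assume st: "a \<le> s" "s \<le> t" "t \<le> b"
  consider "t \<le> u" | "u \<le> s" | "s \<le> u" "u \<le> t"
    by linarith
  then show "norm (f t - f s) \<le> (L + L') * (t - s) powr \<alpha>"
  proof cases
    case 1
    then show ?thesis
      using holder_boundD[OF assms(1) st(1,2)] nn by (intro order_trans[OF _ mult_right_mono[of L "L + L'"]]) auto
  next
    case 2
    then show ?thesis
      using holder_boundD[OF assms(2) _ st(2,3)] nn by (intro order_trans[OF _ mult_right_mono[of L' "L + L'"]]) auto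
  next
    case 3
    have "norm (f t - f s) \<le> norm (f t - f u) + norm (f u - f s)"
      using norm_triangle_ineq[of "f t - f u" "f u - f s"] by simp
    also have "\<dots> \<le> L' * (t - u) powr \<alpha> + L * (u - s) powr \<alpha>"
      using 3 st by (intro add_mono holder_boundD[OF assms(1)] holder_boundD[OF assms(2)]) auto
    also have "\<dots> \<le> L' * (t - s) powr \<alpha> + L * (t - s) powr \<alpha>"
      using 3 nn by (intro add_mono mult_left_mono powr_mono2) auto
    finally show ?thesis
      by (simp add: algebra_simps)
  qed
qed

text \<open>
The seminorm and the supremum are bounded separately since the estimates treat them differently:
on a short interval the second is controlled by the initial value and the first.
\<close>

definition holder_ball :: "real \<Rightarrow> real \<Rightarrow> real \<Rightarrow> real \<Rightarrow> real \<Rightarrow> (real \<Rightarrow> 'e::real_normed_vector) \<Rightarrow> bool" where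
  "holder_ball \<alpha> L m a b f \<longleftrightarrow> holder_bound \<alpha> L a b f \<and> (\<forall>r\<in>{a..b}. norm (f r) \<le> m)"

lemma holder_ballD:
  assumes "holder_ball \<alpha> L m a b f"
  shows "a \<le> s \<Longrightarrow> s \<le> t \<Longrightarrow> t \<le> b \<Longrightarrow> norm (f t - f s) \<le> L * (t - s) powr \<alpha>"
    and "a \<le> s \<Longrightarrow> s \<le> b \<Longrightarrow> norm (f s) \<le> m"
  using assms by (auto simp: holder_ball_def holder_bound_def)

lemma holder_ball_subinterval:
  "holder_ball \<alpha> L m a b f \<Longrightarrow> a \<le> a' \<Longrightarrow> b' \<le> b \<Longrightarrow> holder_ball \<alpha> L m a' b' f"
  by (auto simp: holder_ball_def intro: holder_bound_mono)

lemma holder_ball_nonneg: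
  "holder_ball \<alpha> L m a b f \<Longrightarrow> a \<le> b \<Longrightarrow> 0 \<le> m"
  using holder_ballD(2)[of \<alpha> L m a b f a] norm_ge_zero order_trans by blast

lemma holder_ball_if_bound:
  assumes x: "holder_bound \<alpha> L a b x" and L: "0 \<le> L" and \<alpha>: "0 \<le> \<alpha>"
  shows "holder_ball \<alpha> L (norm (x a) + L * (b - a) powr \<alpha>) a b x"
  unfolding holder_ball_def
proof (intro conjI ballI x)
  fix r assume r: "r \<in> {a..b}"
  have "norm (x r - x a) \<le> L * (r - a) powr \<alpha>"
    using r by (intro holder_boundD[OF x]) auto
  also have "\<dots> \<le> L * (b - a) powr \<alpha>"
    using r L \<alpha> by (intro mult_left_mono powr_mono2) auto
  finally show "norm (x r) \<le> norm (x a) + L * (b - a) powr \<alpha>"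
    using norm_triangle_ineq2[of "x r" "x a"] by linarith
qed

lemma holder_ball_diff:
  assumes "holder_ball \<alpha> L m a b x" "holder_ball \<alpha> L' m' a b y"
  shows "holder_ball \<alpha> (L + L') (m + m') a b (\<lambda>r. x r - y r)"
  unfolding holder_ball_def holder_bound_def
proof (intro conjI allI impI ballI)
  fix s t assume st: "a \<le> s" "s \<le> t" "t \<le> b"
  show "norm (x t - y t - (x s - y s)) \<le> (L + L') * (t - s) powr \<alpha>"
    using norm_triangle_ineq4[of "x t - x s" "y t - y s"] holder_ballD(1)[OF assms(1) st] holder_ballD(1)[OF assms(2) st]
    by (simp add: algebra_simps)
next
  fix r assume "r \<in> {a..b}"
  then show "norm (x r - y r) \<le> m + m'"
    using norm_triangle_ineq4[of "x r" "y r"] holder_ballD(2)[OF assms(1), of r] holder_ballD(2)[OF assms(2), of r] by simp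
qed

lemma holder_seminorm_le_iff:
  assumes "0 \<le> L"
  shows "holder_seminorm \<alpha> {a..b} f \<le> ennreal L \<longleftrightarrow> holder_bound \<alpha> L a b f"
proof
  assume *: "holder_seminorm \<alpha> {a..b} f \<le> ennreal L"
  show "holder_bound \<alpha> L a b f"
    unfolding holder_bound_def
  proof (intro allI impI)
    fix s t assume st: "a \<le> s" "s \<le> t" "t \<le> b"
    show "norm (f t - f s) \<le> L * (t - s) powr \<alpha>"
    proof (cases "s = t")
      case False
      then have "ennreal (norm (f t - f s) / \<bar>t - s\<bar> powr \<alpha>) \<le> ennreal L"
        using bspec[OF *[unfolded holder_seminorm_def SUP_le_iff], of "(s, t)"] st by simp
      then have "norm (f t - f s) / (t - s) powr \<alpha> \<le> L"
        using st assms by (simp add: ennreal_le_iff)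
      then show ?thesis
        using st False by (simp add: divide_le_eq)
    qed simp
  qed
next
  assume f: "holder_bound \<alpha> L a b f"
  have "norm (f t - f s) / \<bar>t - s\<bar> powr \<alpha> \<le> L" if "s \<in> {a..b}" "t \<in> {a..b}" "s \<noteq> t" for s t
  proof -
    have "norm (f t - f s) \<le> L * \<bar>t - s\<bar> powr \<alpha>"
      using holder_boundD[OF f, of s t] holder_boundD[OF f, of t s] that
      by (cases "s \<le> t") (auto simp: norm_minus_commute)
    then show ?thesis
      using that by (simp add: divide_le_eq)
  qed
  then show "holder_seminorm \<alpha> {a..b} f \<le> ennreal L"
    unfolding holder_seminorm_def SUP_le_iff by (auto intro!: ennreal_leI)
qed

lemma sup_norm_on_le_iff:
  assumes "0 \<le> L"
  shows "sup_norm_on J f \<le> ennreal L \<longleftrightarrow> (\<forall>s\<in>J. norm (f s) \<le> L)"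
  unfolding sup_norm_on_def SUP_le_iff using assms by (simp add: ennreal_le_iff)

lemma holder_norm_leI:
  assumes "0 \<le> L" "0 \<le> M" "holder_bound \<alpha> L a b f" "\<And>s. s \<in> {a..b} \<Longrightarrow> norm (f s) \<le> M"
  shows "holder_norm \<alpha> {a..b} f \<le> ennreal (M + L)"
  unfolding holder_norm_def ennreal_plus[OF assms(2,1)]
  using assms by (intro add_mono) (auto simp: holder_seminorm_le_iff sup_norm_on_le_iff)

lemma holder_norm_leD:
  assumes "holder_norm \<alpha> {a..b} f \<le> ennreal R" "0 \<le> R"
  shows "holder_bound \<alpha> R a b f" "s \<in> {a..b} \<Longrightarrow> norm (f s) \<le> R"
proof -
  have "holder_seminorm \<alpha> {a..b} f \<le> ennreal R" "sup_norm_on {a..b} f \<le> ennreal R"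
    using assms(1) unfolding holder_norm_def by (meson add_increasing2 add_increasing order_trans zero_le order_refl)+
  then show "holder_bound \<alpha> R a b f" "s \<in> {a..b} \<Longrightarrow> norm (f s) \<le> R"
    using assms by (auto simp: holder_seminorm_le_iff sup_norm_on_le_iff)
qed

lemma holder_spaceI:
  assumes "0 \<le> L" "0 \<le> M" "holder_bound \<alpha> L a b f" "\<And>s. s \<in> {a..b} \<Longrightarrow> norm (f s) \<le> M"
  shows "f \<in> holder_space \<alpha> {a..b}"
  using holder_norm_leI[OF assms] by (auto simp: holder_space_def intro: le_less_trans)

lemma holder_spaceE:
  assumes "f \<in> holder_space \<alpha> {a..b}"
  obtains L where "0 < L" "holder_norm \<alpha> {a..b} f \<le> ennreal L"
proof -
  define L where "L = enn2real (holder_norm \<alpha> {a..b} f) + 1"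
  have "holder_norm \<alpha> {a..b} f = ennreal (enn2real (holder_norm \<alpha> {a..b} f))"
    using assms by (simp add: holder_space_def)
  also have "\<dots> \<le> ennreal L"
    unfolding L_def by (intro ennreal_leI) simp
  finally show ?thesis
    by (rule that[rotated]) (simp add: L_def add_nonneg_pos)
qed

lemma holder_space_diff:
  assumes "f \<in> holder_space \<alpha> {a..b}" "g \<in> holder_space \<alpha> {a..b}"
  shows "(\<lambda>t. f t - g t) \<in> holder_space \<alpha> {a..b}"
proof -
  obtain L where L: "0 < L" "holder_norm \<alpha> {a..b} f \<le> ennreal L"
    using holder_spaceE[OF assms(1)] .
  obtain M where M: "0 < M" "holder_norm \<alpha> {a..b} g \<le> ennreal M"
    using holder_spaceE[OF assms(2)] .
  have "holder_ball \<alpha> L L a b f" "holder_ball \<alpha> M M a b g"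
    using holder_norm_leD[OF L(2)] holder_norm_leD[OF M(2)] L(1) M(1) by (auto simp: holder_ball_def)
  from holder_ball_diff[OF this] show ?thesis
    using L(1) M(1) by (intro holder_spaceI[of "L + M" "L + M"]) (auto simp: holder_ball_def)
qed

lemma holder_norm_eq_ennreal:
  assumes "f \<in> holder_space \<alpha> {a..b}"
  obtains N where "0 \<le> N" "holder_norm \<alpha> {a..b} f = ennreal N"
  using assms that[of "enn2real (holder_norm \<alpha> {a..b} f)"] by (simp add: holder_space_def)

lemma holder_seminorm_eq_ennreal:
  assumes "f \<in> holder_space \<alpha> {a..b}"
  obtains \<eta> where "0 \<le> \<eta>" "holder_seminorm \<alpha> {a..b} f = ennreal \<eta>"
proof -
  have "holder_seminorm \<alpha> {a..b} f \<le> holder_norm \<alpha> {a..b} f"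
    by (simp add: holder_norm_def)
  then have "holder_seminorm \<alpha> {a..b} f < \<infinity>"
    using assms unfolding holder_space_def by (auto intro: le_less_trans)
  then show ?thesis
    using that[of "enn2real (holder_seminorm \<alpha> {a..b} f)"] by simp
qed

section \<open>The sewing lemma\<close>

text \<open>
The hypothesis of the sewing lemma. At \<open>s = u = t\<close> it forces \<open>A s s = 0\<close>, so degenerate cells of a
partition contribute nothing.
\<close>

definition almost_additive ::
  "real \<Rightarrow> real \<Rightarrow> real \<Rightarrow> real \<Rightarrow> (real \<Rightarrow> real \<Rightarrow> 'e::real_normed_vector) \<Rightarrow> bool" where
  "almost_additive \<gamma> c a b A \<longleftrightarrow>
     (\<forall>s u t. a \<le> s \<longrightarrow> s \<le> u \<longrightarrow> u \<le> t \<longrightarrow> t \<le> b \<longrightarrow>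
        norm (A s t - A s u - A u t) \<le> c * (t - s) powr \<gamma>)"

lemma almost_additiveD:
  "almost_additive \<gamma> c a b A \<Longrightarrow> a \<le> s \<Longrightarrow> s \<le> u \<Longrightarrow> u \<le> t \<Longrightarrow> t \<le> b \<Longrightarrow>
     norm (A s t - A s u - A u t) \<le> c * (t - s) powr \<gamma>"
  by (simp add: almost_additive_def)

lemma almost_additive_diag:
  assumes "almost_additive \<gamma> c a b A" "a \<le> s" "s \<le> b"
  shows "A s s = 0"
  using almost_additiveD[OF assms(1), of s s s] assms by simp

text \<open>
\<open>Y\<close> is a primitive of the germ \<open>A\<close>. For \<open>\<gamma> > 1\<close> it is determined up to a constant.
\<close>

definition sewn ::
  "real \<Rightarrow> real \<Rightarrow> real \<Rightarrow> real \<Rightarrow> (real \<Rightarrow> real \<Rightarrow> 'e::real_normed_vector) \<Rightarrow> (real \<Rightarrow> 'e) \<Rightarrow> bool" where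
  "sewn \<gamma> C a b A Y \<longleftrightarrow>
     (\<forall>s t. a \<le> s \<longrightarrow> s \<le> t \<longrightarrow> t \<le> b \<longrightarrow> norm (Y t - Y s - A s t) \<le> C * (t - s) powr \<gamma>)"

lemma sewnD:
  "sewn \<gamma> C a b A Y \<Longrightarrow> a \<le> s \<Longrightarrow> s \<le> t \<Longrightarrow> t \<le> b \<Longrightarrow> norm (Y t - Y s - A s t) \<le> C * (t - s) powr \<gamma>"
  by (simp add: sewn_def)

lemma sewn_subinterval:
  "sewn \<gamma> C a b A Y \<Longrightarrow> a \<le> a' \<Longrightarrow> b' \<le> b \<Longrightarrow> sewn \<gamma> C a' b' A Y"
  by (simp add: sewn_def)

text \<open>
The solution \<open>C\<close> of \<open>C = 2 powr (1 - \<gamma>) * C + 2\<close>: halving an interval produces two halves, each with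
the factor \<open>(1/2) powr \<gamma>\<close>, and two additivity defects.
\<close>

definition sewing_const :: "real \<Rightarrow> real" where
  "sewing_const \<gamma> = 2 / (1 - 2 powr (1 - \<gamma>))"

lemma two_powr_less_1: "1 < \<gamma> \<Longrightarrow> 2 powr (1 - \<gamma>) < (1::real)"
  using powr_less_mono[of "1 - \<gamma>" 0 2] by simp

lemma sewing_const_pos: "1 < \<gamma> \<Longrightarrow> 0 < sewing_const \<gamma>"
  using two_powr_less_1[of \<gamma>] by (simp add: sewing_const_def)

lemma sewing_const_eq:
  assumes "1 < \<gamma>"
  shows "2 * (sewing_const \<gamma> * (1/2) powr \<gamma>) + 2 = sewing_const \<gamma>"
proof -
  have "(1/2) powr \<gamma> * 2 = (2::real) powr (1 - \<gamma>)"
    by (simp add: powr_diff powr_divide)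
  moreover have "sewing_const \<gamma> * (1 - 2 powr (1 - \<gamma>)) = 2"
    unfolding sewing_const_def using two_powr_less_1[OF assms] by (intro nonzero_divide_mult_cancel_right nonzero_eq_divide_eq[THEN iffD1]) auto
  ultimately show ?thesis
    by (simp add: algebra_simps)
qed

text \<open>
The cell \<open>[p m, p (Suc m)]\<close> is the one that contains the midpoint of \<open>[p i, p j]\<close>; what remains on
either side has at most half the length.
\<close>

lemma split_at_midpoint:
  fixes p :: "nat \<Rightarrow> real"
  assumes "mono p" "i < j"
  obtains m where "i \<le> m" "m < j" "p m - p i \<le> (p j - p i) / 2" "p j - p (Suc m) \<le> (p j - p i) / 2"
proof -
  define S where "S = {k \<in> {i..<j}. p k \<le> (p i + p j) / 2}"
  define m where "m = Max S"
  have pij: "p i \<le> p j"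
    using assms by (auto intro: monoD)
  have "finite S" "i \<in> S"
    using assms pij by (auto simp: S_def)
  then have m: "m \<in> S" and maxm: "\<And>k. k \<in> S \<Longrightarrow> k \<le> m"
    unfolding m_def by (auto intro: Max_in)
  have "p j - p (Suc m) \<le> (p j - p i) / 2"
  proof (cases "Suc m = j")
    case False
    then have "Suc m \<notin> S" "Suc m \<in> {i..<j}"
      using maxm[of "Suc m"] m by (auto simp: S_def)
    then show ?thesis
      by (simp add: S_def field_simps)
  qed (use pij in simp)
  then show ?thesis
    using m by (intro that[of m]) (auto simp: S_def field_simps)
qed

text \<open>
The bound does not depend on the number of points. Cutting out the cell that contains the midpoint
leaves two shorter partitions, to which the induction hypothesis applies; their lengths are at most
half of the original one, so their errors add up to a fraction \<open>2 powr (1 - \<gamma>) < 1\<close> of the bound, and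
the choice of \<open>sewing_const\<close> leaves exactly enough room for the two defects of the cut.
\<close>

lemma sewing_maximal_inequality:
  assumes \<gamma>: "1 < \<gamma>" and c: "0 \<le> c" and A: "almost_additive \<gamma> c a b A"
    and p: "mono p" and ij: "i \<le> j" "a \<le> p i" "p j \<le> b"
  shows "norm ((\<Sum>k=i..<j. A (p k) (p (Suc k))) - A (p i) (p j))
           \<le> sewing_const \<gamma> * c * (p j - p i) powr \<gamma>"
  using ij
proof (induction "j - i" arbitrary: i j rule: less_induct)
  case less
  let ?S = "\<lambda>i j. \<Sum>k=i..<j. A (p k) (p (Suc k))"
  let ?K = "sewing_const \<gamma>"
  have K: "0 \<le> ?K * c"
    using sewing_const_pos[OF \<gamma>] c by simp
  show ?case
  proof (cases "i = j")
    case True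
    then show ?thesis
      using almost_additive_diag[OF A, of "p j"] less.prems by simp
  next
    case False
    then have "i < j"
      using less.prems by simp
    then obtain m where m: "i \<le> m" "m < j"
      and left: "p m - p i \<le> (p j - p i) / 2" and right: "p j - p (Suc m) \<le> (p j - p i) / 2"
      using split_at_midpoint[OF p] by blast
    let ?L = "p j - p i"
    have ord: "p i \<le> p m" "p m \<le> p (Suc m)" "p (Suc m) \<le> p j"
      using m by (auto intro!: monoD[OF p])
    have half: "?K * c * x powr \<gamma> \<le> ?K * c * ((1/2) powr \<gamma> * ?L powr \<gamma>)" if "0 \<le> x" "x \<le> ?L / 2" for x
    proof -
      have "x powr \<gamma> \<le> (1/2 * ?L) powr \<gamma>"
        using that \<gamma> by (intro powr_mono2) auto
      also have "\<dots> = (1/2) powr \<gamma> * ?L powr \<gamma>"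
        using ord by (intro powr_mult) 
      finally show ?thesis
        using K by (intro mult_left_mono)
    qed
    have 1: "norm (?S i m - A (p i) (p m)) \<le> ?K * c * ((1/2) powr \<gamma> * ?L powr \<gamma>)"
      using less.hyps[of m i] half[of "p m - p i"] left ord m less.prems by fastforce
    have 2: "norm (?S (Suc m) j - A (p (Suc m)) (p j)) \<le> ?K * c * ((1/2) powr \<gamma> * ?L powr \<gamma>)"
      using less.hyps[of j "Suc m"] half[of "p j - p (Suc m)"] right ord m less.prems by fastforce
    have 3: "norm (A (p i) (p j) - A (p i) (p m) - A (p m) (p j)) \<le> c * ?L powr \<gamma>"
      using ord less.prems by (intro almost_additiveD[OF A]) auto
    have "norm (A (p m) (p j) - A (p m) (p (Suc m)) - A (p (Suc m)) (p j)) \<le> c * (p j - p m) powr \<gamma>"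
      using ord less.prems by (intro almost_additiveD[OF A]) auto
    also have "\<dots> \<le> c * ?L powr \<gamma>"
      using ord c \<gamma> by (intro mult_left_mono powr_mono2) auto
    finally have 4: "norm (A (p m) (p j) - A (p m) (p (Suc m)) - A (p (Suc m)) (p j)) \<le> c * ?L powr \<gamma>" .
    \<comment> \<open>Facts 1 and 2 are the errors of the two sides, 3 and 4 the defects of removing the cell.\<close>
    have "?S i j = ?S i m + ?S m j"
      using m by (intro sum.atLeastLessThan_concat[symmetric]) auto
    also have "?S m j = A (p m) (p (Suc m)) + ?S (Suc m) j"
      using m by (simp add: sum.atLeast_Suc_lessThan)
    finally have "?S i j - A (p i) (p j) =
       (?S i m - A (p i) (p m)) + (?S (Suc m) j - A (p (Suc m)) (p j))
       - (A (p i) (p j) - A (p i) (p m) - A (p m) (p j))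
       - (A (p m) (p j) - A (p m) (p (Suc m)) - A (p (Suc m)) (p j))"
      by simp
    also have "norm \<dots> \<le> (?K * c * ((1/2) powr \<gamma> * ?L powr \<gamma>) + ?K * c * ((1/2) powr \<gamma> * ?L powr \<gamma>)
        + c * ?L powr \<gamma>) + c * ?L powr \<gamma>"
      by (intro norm_triangle_le_diff norm_triangle_le add_mono 1 2 3 4)
    also have "\<dots> = (2 * (?K * (1/2) powr \<gamma>) + 2) * c * ?L powr \<gamma>"
      by (simp add: algebra_simps)
    finally show ?thesis
      by (simp only: sewing_const_eq[OF \<gamma>])
  qed
qed

lemma convergent_geometric_increments:
  fixes u :: "nat \<Rightarrow> 'e::banach"
  assumes r: "0 \<le> r" "r < 1" and u: "\<And>n. norm (u (Suc n) - u n) \<le> C * r ^ n"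
  shows "convergent u"
proof -
  have "summable (\<lambda>n. u (Suc n) - u n)"
    using r by (intro summable_comparison_test'[OF summable_mult[OF summable_geometric] u]) auto
  then have "convergent (\<lambda>m. \<Sum>n<m. u (Suc n) - u n)"
    by (simp add: summable_iff_convergent)
  then have "convergent (\<lambda>m. u 0 + (u m - u 0))"
    unfolding sum_lessThan_telescope by (intro convergent_add convergent_const)
  then show ?thesis
    by simp
qed

lemma sum_pairs: "(\<Sum>i<2 * (n::nat). F i) = (\<Sum>i<n. F (2 * i) + F (Suc (2 * i)))"
  for F :: "nat \<Rightarrow> 'e::comm_monoid_add"
  by (induction n) (simp_all add: add.assoc)

text \<open>
Riemann sums over the grid \<open>p\<close>, stopped at \<open>s\<close> and at \<open>t\<close>, share all cells up to the last grid point
before \<open>s\<close>. The maximal inequality replaces each of the remaining two sums by the value of the germ on one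
interval of length at most \<open>t - s + h\<close>; as \<open>h\<close> tends to \<open>0\<close> the bound becomes the one that defines
\<open>sewn\<close>.
\<close>

lemma sewing_local_bound:
  assumes \<gamma>: "1 < \<gamma>" and c: "0 \<le> c" and A: "almost_additive \<gamma> c a b A"
    and p: "\<And>i. p i = a + real i * h" and h: "0 < h" and b: "b = a + real N * h"
    and st: "a \<le> s" "s \<le> t" "t \<le> b"
  shows "norm ((\<Sum>i<N. A (min (p i) t) (min (p (Suc i)) t)) - (\<Sum>i<N. A (min (p i) s) (min (p (Suc i)) s)) - A s t)
           \<le> (2 * sewing_const \<gamma> + 1) * c * (t - s + h) powr \<gamma>"
proof -
  let ?K = "sewing_const \<gamma>"
  define F where "F r i = A (min (p i) r) (min (p (Suc i)) r)" for r i
  \<comment> \<open>\<open>p k\<close> is the last grid point not after \<open>s\<close>; for \<open>s = b\<close> this is \<open>k = N\<close> with empty tails.\<close>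
  define k where "k = nat \<lfloor>(s - a) / h\<rfloor>"
  have "real k \<le> (s - a) / h" "(s - a) / h < real k + 1"
    using st h by (auto simp: k_def)
  then have k: "p k \<le> s" "s < p k + h"
    using h by (auto simp: p field_simps)
  have "real k * h \<le> real N * h"
    using k st b unfolding p by linarith
  then have kN: "k \<le> N"
    using h by simp
  have mono: "mono (\<lambda>i. min (p i) r)" for r
    unfolding mono_def p using h by (intro allI impI min.mono add_mono mult_right_mono order_refl) auto
  have ap: "a \<le> p k" and pN: "p N = b"
    using h b by (auto simp: p)
  have tail: "norm ((\<Sum>i=k..<N. F r i) - A (p k) r) \<le> ?K * c * (t - s + h) powr \<gamma>"
    if r: "s \<le> r" "r \<le> t" for r
  proof -
    have "norm ((\<Sum>i=k..<N. F r i) - A (min (p k) r) (min (p N) r)) \<le> ?K * c * (min (p N) r - min (p k) r) powr \<gamma>"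
      unfolding F_def using r st ap
      by (intro sewing_maximal_inequality[OF \<gamma> c A mono kN]) auto
    moreover have "min (p k) r = p k" "min (p N) r = r"
      using k pN r st by auto
    moreover have "?K * c * (r - p k) powr \<gamma> \<le> ?K * c * (t - s + h) powr \<gamma>"
      using k r \<gamma> c sewing_const_pos[OF \<gamma>] by (intro mult_left_mono powr_mono2) auto
    ultimately show ?thesis
      by simp
  qed
  have head: "(\<Sum>i<k. F t i) = (\<Sum>i<k. F s i)"
  proof (intro sum.cong refl)
    fix i assume "i \<in> {..<k}"
    then have "real (Suc i) * h \<le> real k * h"
      using h by (intro mult_right_mono) auto
    then have "p i \<le> p (Suc i)" "p (Suc i) \<le> p k"
      using h by (auto simp: p algebra_simps)
    then have "p i \<le> s" "p (Suc i) \<le> s"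
      using k by auto
    then show "F t i = F s i"
      using st by (simp add: F_def min_def)
  qed
  have "norm (A (p k) t - A (p k) s - A s t) \<le> c * (t - p k) powr \<gamma>"
    using ap k st by (intro almost_additiveD[OF A]) auto
  also have "\<dots> \<le> c * (t - s + h) powr \<gamma>"
    using k st \<gamma> c by (intro mult_left_mono powr_mono2) auto
  finally have split: "norm (A (p k) t - A (p k) s - A s t) \<le> c * (t - s + h) powr \<gamma>" .
  have dec: "(\<Sum>i<N. F r i) = (\<Sum>i<k. F r i) + (\<Sum>i=k..<N. F r i)" for r
    using sum.atLeastLessThan_concat[of 0 k N "F r"] kN by (simp add: atLeast0LessThan)
  have "(\<Sum>i<N. F t i) - (\<Sum>i<N. F s i) - A s t =
      ((\<Sum>i=k..<N. F t i) - A (p k) t) - ((\<Sum>i=k..<N. F s i) - A (p k) s) + (A (p k) t - A (p k) s - A s t)"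
    unfolding dec head by simp
  also have "norm \<dots> \<le> (?K * c * (t - s + h) powr \<gamma> + ?K * c * (t - s + h) powr \<gamma>) + c * (t - s + h) powr \<gamma>"
    using st by (intro norm_triangle_le norm_triangle_le_diff add_mono tail split) auto
  finally show ?thesis
    by (simp add: F_def algebra_simps)
qed

text \<open>
Riemann sums along dyadic grids, stopped at \<open>t\<close>: refining one level costs \<open>2 ^ n\<close> defects of order
\<open>(2 powr (- n)) powr \<gamma>\<close>, which is summable because \<open>\<gamma> > 1\<close>. The limit is taken for a path rather than for
each interval separately, so its increments are additive by construction.
\<close>

lemma sewing_exists:
  fixes A :: "real \<Rightarrow> real \<Rightarrow> 'e::banach"
  assumes \<gamma>: "1 < \<gamma>" and c: "0 \<le> c" and ab: "a < b" and A: "almost_additive \<gamma> c a b A"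
  obtains Y where "sewn \<gamma> ((2 * sewing_const \<gamma> + 1) * c) a b A Y"
proof -
  define h where "h n = (b - a) / 2 ^ n" for n :: nat
  define p where "p n i = a + real i * h n" for n i
  \<comment> \<open>Cutting the points off at \<open>t\<close> turns the cells beyond \<open>t\<close> into \<open>A t t = 0\<close>.\<close>
  define Yn where "Yn n t = (\<Sum>i<(2::nat) ^ n. A (min (p n i) t) (min (p n (Suc i)) t))" for n t
  have h: "0 < h n" "b = a + real (2 ^ n) * h n" for n
    using ab by (auto simp: h_def)
  have step: "norm (Yn (Suc n) t - Yn n t) \<le> c * (b - a) powr \<gamma> * (2 powr (1 - \<gamma>)) ^ n"
    if t: "a \<le> t" "t \<le> b" for n t
  proof -
    let ?l = "\<lambda>i. min (p n i) t" and ?m = "\<lambda>i. min (p (Suc n) (Suc (2 * i))) t"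
    have halve: "h n = 2 * h (Suc n)"
      by (simp add: h_def field_simps)
    have refine: "p (Suc n) (2 * i) = p n i" "p (Suc n) (Suc (Suc (2 * i))) = p n (Suc i)" for i
      by (auto simp: p_def h_def field_simps)
    have "Yn (Suc n) t - Yn n t = (\<Sum>i<(2::nat) ^ n. - (A (?l i) (?l (Suc i)) - A (?l i) (?m i) - A (?m i) (?l (Suc i))))"
      unfolding Yn_def power_Suc sum_pairs refine by (simp add: sum_subtractf[symmetric] algebra_simps)
    also have "norm \<dots> \<le> (\<Sum>i<(2::nat) ^ n. c * h n powr \<gamma>)"
    proof (intro sum_norm_le)
      fix i
      have o: "a \<le> p n i" "p n i \<le> p (Suc n) (Suc (2 * i))" "p (Suc n) (Suc (2 * i)) \<le> p n (Suc i)"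
        "p n (Suc i) = p n i + h n"
        using h(1)[of n] h(1)[of "Suc n"] by (auto simp: p_def halve algebra_simps)
      have "norm (A (?l i) (?l (Suc i)) - A (?l i) (?m i) - A (?m i) (?l (Suc i))) \<le> c * (?l (Suc i) - ?l i) powr \<gamma>"
        using o t by (intro almost_additiveD[OF A]) (auto simp: min_def)
      also have "\<dots> \<le> c * h n powr \<gamma>"
        using o h(1)[of n] c \<gamma> by (intro mult_left_mono powr_mono2) (auto simp: min_def)
      finally show "norm (- (A (?l i) (?l (Suc i)) - A (?l i) (?m i) - A (?m i) (?l (Suc i)))) \<le> c * h n powr \<gamma>"
        by (simp add: norm_minus_commute)
    qed
    also have "\<dots> = c * (b - a) powr \<gamma> * (2 ^ n / (2 ^ n) powr \<gamma>)"
      using ab by (simp add: h_def powr_divide)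
    also have "(2 ^ n / (2 ^ n) powr \<gamma> :: real) = (2 powr (1 - \<gamma>)) ^ n"
    proof -
      have "(2 ^ n / (2 ^ n) powr \<gamma> :: real) = 2 powr (real n - real n * \<gamma>)"
        by (simp add: powr_diff powr_powr powr_realpow[symmetric])
      also have "\<dots> = (2 powr (1 - \<gamma>)) powr real n"
        by (simp add: powr_powr algebra_simps)
      finally show ?thesis
        by (simp add: powr_realpow)
    qed
    finally show ?thesis .
  qed
  define Y where "Y t = lim (\<lambda>n. Yn n t)" for t
  have lim: "(\<lambda>n. Yn n t) \<longlonglongrightarrow> Y t" if "a \<le> t" "t \<le> b" for t
    unfolding Y_def convergent_LIMSEQ_iff[symmetric]
    by (rule convergent_geometric_increments[OF _ two_powr_less_1[OF \<gamma>] step[OF that]]) simp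
  have h0: "h \<longlonglongrightarrow> 0"
    unfolding h_def by (rule LIMSEQ_divide_realpow_zero) simp
  have "sewn \<gamma> ((2 * sewing_const \<gamma> + 1) * c) a b A Y"
    unfolding sewn_def
  proof (intro allI impI)
    fix s t assume st: "a \<le> s" "s \<le> t" "t \<le> b"
    have "(\<lambda>n. (2 * sewing_const \<gamma> + 1) * c * (t - s + h n) powr \<gamma>)
       \<longlonglongrightarrow> (2 * sewing_const \<gamma> + 1) * c * (t - s + 0) powr \<gamma>"
      using st h(1) \<gamma> less_imp_le[OF h(1)]
      by (intro tendsto_mult tendsto_const tendsto_powr' tendsto_add h0)
        (auto intro!: always_eventually add_nonneg_nonneg)
    moreover have "(\<lambda>n. norm (Yn n t - Yn n s - A s t)) \<longlonglongrightarrow> norm (Y t - Y s - A s t)"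
      using st by (intro tendsto_intros lim) auto
    moreover have "norm (Yn n t - Yn n s - A s t) \<le> (2 * sewing_const \<gamma> + 1) * c * (t - s + h n) powr \<gamma>" for n
      unfolding Yn_def by (rule sewing_local_bound[OF \<gamma> c A p_def h st])
    ultimately show "norm (Y t - Y s - A s t) \<le> (2 * sewing_const \<gamma> + 1) * c * (t - s) powr \<gamma>"
      using LIMSEQ_le by (metis (no_types, lifting) add.right_neutral)
  qed
  then show ?thesis
    by (rule that)
qed

lemma uniform_partition_error_tendsto_0:
  assumes "1 < \<gamma>"
  shows "(\<lambda>n. C * L powr \<gamma> * real (Suc n) powr (1 - \<gamma>)) \<longlonglongrightarrow> 0"
proof -
  have "(\<lambda>n. real (Suc n) powr (1 - \<gamma>)) \<longlonglongrightarrow> 0"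
    using assms by (intro tendsto_neg_powr filterlim_compose[OF filterlim_real_sequentially filterlim_Suc]) simp
  then show ?thesis
    by (rule tendsto_mult_right_zero)
qed

text \<open>
With any constant \<open>C\<close>, the error of \<open>Y\<close> against the Riemann sum over \<open>N\<close> equal cells is at most
\<open>C * (t - s) powr \<gamma> * N powr (1 - \<gamma>)\<close> and vanishes in the limit, while the maximal inequality bounds
the Riemann sum uniformly in \<open>N\<close>. This gives constants that do not depend on how \<open>Y\<close> was obtained, and
in particular applies to solutions about which nothing quantitative is known.
\<close>

lemma sewn_improve:
  assumes \<gamma>: "1 < \<gamma>" and c: "0 \<le> c" and A: "almost_additive \<gamma> c a b A" and Y: "sewn \<gamma> C a b A Y"
  shows "sewn \<gamma> (sewing_const \<gamma> * c) a b A Y"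
  unfolding sewn_def
proof (intro allI impI)
  fix s t assume st: "a \<le> s" "s \<le> t" "t \<le> b"
  let ?B = "sewing_const \<gamma> * c * (t - s) powr \<gamma>"
  have "norm (Y t - Y s - A s t) \<le> C * (t - s) powr \<gamma> * real (Suc n) powr (1 - \<gamma>) + ?B" for n
  proof -
    let ?N = "real (Suc n)"
    define p where "p k = s + real k * ((t - s) / ?N)" for k
    have p: "mono p" "p 0 = s" "p (Suc n) = t"
      using st by (auto simp: p_def mono_def intro!: mult_right_mono divide_right_mono simp del: of_nat_Suc)
    have p_le: "s \<le> p k" "p k \<le> t" if "k \<le> Suc n" for k
      using monoD[OF p(1), of 0 k] monoD[OF p(1), of k "Suc n"] that p by auto
    have inc: "p (Suc k) - p k = (t - s) / ?N" for k
      by (simp add: p_def algebra_simps flip: add_divide_distrib diff_divide_distrib)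
    have "Y t - Y s - A s t = (\<Sum>k<Suc n. Y (p (Suc k)) - Y (p k) - A (p k) (p (Suc k)))
       + ((\<Sum>k=0..<Suc n. A (p k) (p (Suc k))) - A (p 0) (p (Suc n)))"
      unfolding sum_subtractf[of "\<lambda>k. Y (p (Suc k)) - Y (p k)"] sum_lessThan_telescope[of "\<lambda>k. Y (p k)"] p
      by (simp add: atLeast0LessThan)
    also have "norm \<dots> \<le> (\<Sum>k<Suc n. C * ((t - s) / ?N) powr \<gamma>) + sewing_const \<gamma> * c * (p (Suc n) - p 0) powr \<gamma>"
    proof (intro norm_triangle_le add_mono sum_norm_le)
      fix k assume "k \<in> {..<Suc n}"
      then show "norm (Y (p (Suc k)) - Y (p k) - A (p k) (p (Suc k))) \<le> C * ((t - s) / ?N) powr \<gamma>"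
        using sewnD[OF Y, of "p k" "p (Suc k)"] p_le[of k] p_le[of "Suc k"] st monoD[OF p(1), of k "Suc k"]
        by (simp add: inc del: of_nat_Suc)
    qed (use st p in \<open>intro sewing_maximal_inequality[OF \<gamma> c A]; simp\<close>)
    also have "(\<Sum>k<Suc n. C * ((t - s) / ?N) powr \<gamma>) = C * (t - s) powr \<gamma> * ?N powr (1 - \<gamma>)"
      using st by (simp add: powr_divide powr_diff field_simps del: of_nat_Suc)
    finally show ?thesis
      using p by simp
  qed
  then have "norm (Y t - Y s - A s t) \<le> 0 + ?B"
    by (intro LIMSEQ_le_const[OF tendsto_add[OF uniform_partition_error_tendsto_0[OF \<gamma>, of C] tendsto_const]]) auto
  then show "norm (Y t - Y s - A s t) \<le> ?B"
    by simp
qed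

text \<open>
Across the joint \<open>u\<close> the only new error is one additivity defect.
\<close>

lemma sewn_concat:
  assumes 1: "sewn \<gamma> C a u A Y" and 2: "sewn \<gamma> C' u b A Y" and A: "almost_additive \<gamma> c a b A"
    and nn: "0 \<le> C" "0 \<le> C'" "0 \<le> c" "0 \<le> \<gamma>"
  shows "sewn \<gamma> (C + C' + c) a b A Y"
  unfolding sewn_def
proof (intro allI impI)
  fix s t assume st: "a \<le> s" "s \<le> t" "t \<le> b"
  consider "t \<le> u" | "u \<le> s" | "s \<le> u" "u \<le> t"
    by linarith
  then show "norm (Y t - Y s - A s t) \<le> (C + C' + c) * (t - s) powr \<gamma>"
  proof cases
    case 1
    then show ?thesis
      using sewnD[OF assms(1) st(1,2)] nn by (intro order_trans[OF _ mult_right_mono[of C "C + C' + c"]]) auto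
  next
    case 2
    then show ?thesis
      using sewnD[OF assms(2) _ st(2,3)] nn by (intro order_trans[OF _ mult_right_mono[of C' "C + C' + c"]]) auto
  next
    case 3
    have "Y t - Y s - A s t = (Y t - Y u - A u t) + (Y u - Y s - A s u) - (A s t - A s u - A u t)"
      by simp
    also have "norm \<dots> \<le> C' * (t - u) powr \<gamma> + C * (u - s) powr \<gamma> + c * (t - s) powr \<gamma>"
      using 3 st by (intro norm_triangle_le_diff norm_triangle_le add_mono
          sewnD[OF assms(1)] sewnD[OF assms(2)] almost_additiveD[OF A]) auto
    also have "\<dots> \<le> C' * (t - s) powr \<gamma> + C * (t - s) powr \<gamma> + c * (t - s) powr \<gamma>"
      using 3 nn by (intro add_mono mult_left_mono powr_mono2) auto
    finally show ?thesis
      by (simp add: algebra_simps)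
  qed
qed

text \<open>
On an interval of length at most \<open>T\<close> the factor \<open>(b - a) powr \<alpha>\<close> of the sewing error is absorbed
into the constant, so both terms have the order \<open>\<beta>\<close> of the driver.
\<close>

lemma sewn_increment_bound:
  assumes \<gamma>: "1 < \<alpha> + \<beta>" and \<alpha>: "0 < \<alpha>" and c: "0 \<le> c" and A: "almost_additive (\<alpha> + \<beta>) c a b A"
    and Y: "sewn (\<alpha> + \<beta>) C a b A Y" and d: "norm (A a b) \<le> d * (b - a) powr \<beta>"
    and ab: "a \<le> b" "b - a \<le> T"
  shows "norm (Y b - Y a) \<le> (sewing_const (\<alpha> + \<beta>) * T powr \<alpha> * c + d) * (b - a) powr \<beta>"
proof -
  have "norm (Y b - Y a - A a b) \<le> sewing_const (\<alpha> + \<beta>) * c * (b - a) powr (\<alpha> + \<beta>)"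
    using sewnD[OF sewn_improve[OF \<gamma> c A Y]] ab by simp
  also have "\<dots> = sewing_const (\<alpha> + \<beta>) * c * ((b - a) powr \<alpha> * (b - a) powr \<beta>)"
    by (simp add: powr_add)
  also have "\<dots> \<le> sewing_const (\<alpha> + \<beta>) * c * (T powr \<alpha> * (b - a) powr \<beta>)"
    using ab \<alpha> c sewing_const_pos[OF \<gamma>] by (intro mult_left_mono mult_right_mono powr_mono2) auto
  finally have "norm (Y b - Y a - A a b) \<le> sewing_const (\<alpha> + \<beta>) * c * (T powr \<alpha> * (b - a) powr \<beta>)" .
  then show ?thesis
    using d norm_triangle_ineq2[of "Y b - Y a" "A a b"] by (simp add: algebra_simps)
qed

section \<open>Young integrals\<close>

definition young_germ ::
  "(real \<Rightarrow> ('v::real_normed_vector \<Rightarrow>\<^sub>L 'x::real_normed_vector)) \<Rightarrow> (real \<Rightarrow> 'v) \<Rightarrow> real \<Rightarrow> real \<Rightarrow> 'x" where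
  "young_germ f g s t = blinfun_apply (f s) (g t - g s)"

text \<open>
The defect is \<open>(f s - f u) (g t - g u)\<close>, whence the exponents add.
\<close>

lemma young_germ_almost_additive:
  assumes f: "holder_bound \<alpha> L a b f" and g: "holder_bound \<beta> G a b g"
    and "0 \<le> L" "0 \<le> G" "0 < \<alpha>" "0 < \<beta>"
  shows "almost_additive (\<alpha> + \<beta>) (L * G) a b (young_germ f g)"
  unfolding almost_additive_def
proof (intro allI impI)
  fix s u t assume o: "a \<le> s" "s \<le> u" "u \<le> t" "t \<le> b"
  have "young_germ f g s t - young_germ f g s u - young_germ f g u t = blinfun_apply (f s - f u) (g t - g u)"
    by (simp add: young_germ_def blinfun.bilinear_simps)
  also have "norm \<dots> \<le> norm (f u - f s) * norm (g t - g u)"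
    by (metis norm_blinfun norm_minus_commute)
  also have "\<dots> \<le> (L * (u - s) powr \<alpha>) * (G * (t - u) powr \<beta>)"
    using o assms by (intro mult_mono holder_boundD[OF f] holder_boundD[OF g]) auto
  also have "\<dots> \<le> (L * (t - s) powr \<alpha>) * (G * (t - s) powr \<beta>)"
    using o assms by (intro mult_mono powr_mono2 mult_left_mono) auto
  also have "\<dots> = L * G * (t - s) powr (\<alpha> + \<beta>)"
    by (simp add: powr_add)
  finally show "norm (young_germ f g s t - young_germ f g s u - young_germ f g u t)
     \<le> L * G * (t - s) powr (\<alpha> + \<beta>)" .
qed

lemma young_germ_bound:
  assumes "norm (f s) \<le> m" "holder_bound \<beta> G a b g" "a \<le> s" "s \<le> t" "t \<le> b" "0 \<le> m"
  shows "norm (young_germ f g s t) \<le> m * G * (t - s) powr \<beta>"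
proof -
  have "norm (young_germ f g s t) \<le> norm (f s) * norm (g t - g s)"
    by (simp add: young_germ_def norm_blinfun)
  also have "\<dots> \<le> m * (G * (t - s) powr \<beta>)"
    using assms by (intro mult_mono holder_boundD[OF assms(2)]) auto
  finally show ?thesis
    by (simp add: mult.assoc)
qed

lemma interval_partition_bounds:
  assumes "interval_partition a b n p" "i \<le> n"
  shows "a \<le> p i" "p i \<le> b"
proof -
  have p: "p 0 = a" "p n = b" "\<And>i. i < n \<Longrightarrow> p i < p (Suc i)"
    using assms by (auto simp: interval_partition_def)
  have "i \<le> n \<longrightarrow> p 0 \<le> p i" for i
  proof (induction i)
    case (Suc i)
    then show ?case
      using p(3)[of i] by auto
  qed simp
  then show "a \<le> p i"
    using assms p by simp
  have "i + k \<le> n \<longrightarrow> p i \<le> p (i + k)" for k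
  proof (induction k)
    case (Suc k)
    then show ?case
      using p(3)[of "i + k"] by auto
  qed simp
  from this[of "n - i"] show "p i \<le> b"
    using assms p by simp
qed

text \<open>
The increments of \<open>Y\<close> telescope, so a Riemann sum differs from \<open>Y t - Y a\<close> by at most the sum of
\<open>C * (p (Suc i) - p i) powr \<gamma>\<close>, which is at most \<open>C * \<delta> powr (\<gamma> - 1) * (t - a)\<close> for mesh \<open>\<delta>\<close>.
\<close>

lemma has_young_integral_if_sewn:
  assumes \<gamma>: "1 < \<gamma>" and C: "0 \<le> C" and Y: "sewn \<gamma> C a b (young_germ f g) Y" and t: "a \<le> t" "t \<le> b"
  shows "has_young_integral f g a t (Y t - Y a)"
  unfolding has_young_integral_def
proof (intro allI impI)
  fix \<epsilon> :: real assume \<epsilon>: "0 < \<epsilon>"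
  \<comment> \<open>The summand \<open>1\<close> avoids a zero denominator when \<open>C = 0\<close> or \<open>t = a\<close>.\<close>
  define e where "e = \<epsilon> / (C * (t - a) + 1)"
  have den: "0 < C * (t - a) + 1"
    using C t by (simp add: add_nonneg_pos)
  then have e: "0 < e"
    using \<epsilon> by (simp add: e_def)
  define \<delta> where "\<delta> = e powr (1 / (\<gamma> - 1))"
  have \<delta>: "0 < \<delta>" "\<delta> powr (\<gamma> - 1) = e"
    using e \<gamma> by (auto simp: \<delta>_def powr_powr)
  show "\<exists>\<delta>>0. \<forall>n p. interval_partition a t n p \<and> (\<forall>i<n. p (Suc i) - p i < \<delta>) \<longrightarrow>
      norm ((\<Sum>i<n. blinfun_apply (f (p i)) (g (p (Suc i)) - g (p i))) - (Y t - Y a)) < \<epsilon>"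
  proof (intro exI[of _ \<delta>] conjI allI impI \<delta>, elim conjE)
    fix n p assume P: "interval_partition a t n p" and mesh: "\<forall>i<n. p (Suc i) - p i < \<delta>"
    have p: "p 0 = a" "p n = t" and inc: "\<And>i. i < n \<Longrightarrow> p i < p (Suc i)"
      using P by (auto simp: interval_partition_def)
    have cell: "norm (young_germ f g (p i) (p (Suc i)) - (Y (p (Suc i)) - Y (p i))) \<le> C * e * (p (Suc i) - p i)"
      if i: "i < n" for i
    proof -
      have "norm (young_germ f g (p i) (p (Suc i)) - (Y (p (Suc i)) - Y (p i))) \<le> C * (p (Suc i) - p i) powr \<gamma>"
        using sewnD[OF Y, of "p i" "p (Suc i)"] interval_partition_bounds[OF P, of i]
          interval_partition_bounds[OF P, of "Suc i"] inc[OF i] i t by (simp add: norm_minus_commute)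
      also have "(p (Suc i) - p i) powr \<gamma> = (p (Suc i) - p i) powr (\<gamma> - 1) * (p (Suc i) - p i)"
        using inc[OF i] by (simp add: powr_diff)
      also have "C * ((p (Suc i) - p i) powr (\<gamma> - 1) * (p (Suc i) - p i)) \<le> C * (\<delta> powr (\<gamma> - 1) * (p (Suc i) - p i))"
        using inc[OF i] mesh i \<gamma> C by (intro mult_left_mono mult_right_mono powr_mono2) (auto intro: less_imp_le)
      finally show ?thesis
        by (simp add: \<delta> mult.assoc)
    qed
    have "(\<Sum>i<n. blinfun_apply (f (p i)) (g (p (Suc i)) - g (p i))) - (Y t - Y a)
       = (\<Sum>i<n. young_germ f g (p i) (p (Suc i)) - (Y (p (Suc i)) - Y (p i)))"
      unfolding sum_subtractf[of _ "\<lambda>i. Y (p (Suc i)) - Y (p i)"] sum_lessThan_telescope[of "\<lambda>i. Y (p i)"] p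
      by (simp add: young_germ_def)
    also have "norm \<dots> \<le> (\<Sum>i<n. C * e * (p (Suc i) - p i))"
      using cell by (intro sum_norm_le) auto
    also have "\<dots> = C * (t - a) * e"
      unfolding sum_distrib_left[symmetric] sum_lessThan_telescope p by simp
    also have "\<dots> < (C * (t - a) + 1) * e"
      using e by (simp add: algebra_simps)
    also have "\<dots> = \<epsilon>"
      using den by (simp add: e_def)
    finally show "norm ((\<Sum>i<n. blinfun_apply (f (p i)) (g (p (Suc i)) - g (p i))) - (Y t - Y a)) < \<epsilon>" .
  qed
qed

lemma fine_partition_exists:
  assumes "a \<le> b" "0 < \<delta>"
  obtains n p where "interval_partition a b n p" "\<forall>i<n. p (Suc i) - p i < \<delta>"
proof (cases "a = b")
  case True
  then show ?thesis
    by (intro that[of 0 "\<lambda>_. a"]) (auto simp: interval_partition_def)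
next
  case False
  obtain n where n: "(b - a) / \<delta> < real n"
    using reals_Archimedean2 by blast
  moreover have "0 < (b - a) / \<delta>"
    using assms False by simp
  ultimately have n0: "0 < real n"
    by linarith
  have "(b - a) / real n < \<delta>"
    using n n0 assms by (simp add: field_simps)
  moreover have "a + real (Suc i) * ((b - a) / real n) - (a + real i * ((b - a) / real n)) = (b - a) / real n" for i
    by (simp add: distrib_right add_divide_distrib)
  moreover have "0 < (b - a) / real n"
    using n0 assms False by simp
  ultimately show ?thesis
    using n0 by (intro that[of n "\<lambda>i. a + real i * ((b - a) / real n)"])
      (auto simp: interval_partition_def simp del: of_nat_Suc, auto simp: algebra_simps)
qed

lemma has_young_integral_unique:
  assumes I: "has_young_integral f g a b I" and J: "has_young_integral f g a b J" and "a \<le> b"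
  shows "I = J"
proof (rule ccontr)
  assume "I \<noteq> J"
  then have e: "0 < norm (I - J) / 2"
    by simp
  let ?S = "\<lambda>n p. \<Sum>i<n. blinfun_apply (f (p i)) (g (p (Suc i)) - g (p i))"
  obtain d where d: "0 < d"
    "\<And>n p. interval_partition a b n p \<Longrightarrow> (\<forall>i<n. p (Suc i) - p i < d) \<Longrightarrow> norm (?S n p - I) < norm (I - J) / 2"
    using I[unfolded has_young_integral_def, rule_format, OF e] by blast
  obtain d' where d': "0 < d'"
    "\<And>n p. interval_partition a b n p \<Longrightarrow> (\<forall>i<n. p (Suc i) - p i < d') \<Longrightarrow> norm (?S n p - J) < norm (I - J) / 2"
    using J[unfolded has_young_integral_def, rule_format, OF e] by blast
  obtain n p where p: "interval_partition a b n p" "\<forall>i<n. p (Suc i) - p i < min d d'"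
    using fine_partition_exists[of a b "min d d'"] \<open>a \<le> b\<close> d d' by auto
  have "norm (?S n p - I) < norm (I - J) / 2"
    using p by (intro d) auto
  moreover have "norm (?S n p - J) < norm (I - J) / 2"
    using p by (intro d') auto
  moreover have "norm (I - J) \<le> norm (?S n p - I) + norm (?S n p - J)"
    using norm_triangle_ineq4[of "?S n p - J" "?S n p - I"] by simp
  ultimately show False
    by linarith
qed

text \<open>
The indefinite integral is the path that the sewing lemma provides, by uniqueness of limits of
Riemann sums.
\<close>

lemma sewn_if_has_young_integral:
  fixes f :: "real \<Rightarrow> ('v::real_normed_vector \<Rightarrow>\<^sub>L 'x::banach)"
  assumes f: "holder_bound \<alpha> L a b f" and g: "holder_bound \<beta> G a b g"
    and nn: "0 \<le> L" "0 \<le> G" "0 < \<alpha>" "0 < \<beta>" and \<gamma>: "1 < \<alpha> + \<beta>" and ab: "a < b"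
    and x: "\<And>t. t \<in> {a..b} \<Longrightarrow> \<exists>I. has_young_integral f g a t I \<and> x t = x0 + I"
  shows "sewn (\<alpha> + \<beta>) (sewing_const (\<alpha> + \<beta>) * (L * G)) a b (young_germ f g) x" "x a = x0"
proof -
  let ?c = "(2 * sewing_const (\<alpha> + \<beta>) + 1) * (L * G)"
  have c: "0 \<le> L * G" "0 \<le> ?c"
    using nn sewing_const_pos[OF \<gamma>] by auto
  have A: "almost_additive (\<alpha> + \<beta>) (L * G) a b (young_germ f g)"
    by (rule young_germ_almost_additive[OF f g nn])
  obtain Y where Y: "sewn (\<alpha> + \<beta>) ?c a b (young_germ f g) Y"
    using sewing_exists[OF \<gamma> c(1) ab A] .
  have xY: "x t = x0 + (Y t - Y a)" if "t \<in> {a..b}" for t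
    using x[OF that] that has_young_integral_unique[OF _ has_young_integral_if_sewn[OF \<gamma> c(2) Y]] by auto
  then have "sewn (\<alpha> + \<beta>) ?c a b (young_germ f g) x"
    using Y by (simp add: sewn_def)
  then show "sewn (\<alpha> + \<beta>) (sewing_const (\<alpha> + \<beta>) * (L * G)) a b (young_germ f g) x"
    by (rule sewn_improve[OF \<gamma> c(1) A])
  show "x a = x0"
    using xY[of a] ab by simp
qed

section \<open>From short intervals to long ones\<close>

text \<open>
A closed inequality for \<open>y\<close>: a Hoelder constant \<open>L\<close> of order \<open>\<alpha>\<close> on a subinterval is
returned as an increment bound of the higher order \<open>\<beta>\<close>.
\<close>

definition growth_controlled ::
  "real \<Rightarrow> real \<Rightarrow> real \<Rightarrow> real \<Rightarrow> real \<Rightarrow> real \<Rightarrow> (real \<Rightarrow> 'e::real_normed_vector) \<Rightarrow> bool" where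
  "growth_controlled \<kappa> \<rho> \<alpha> \<beta> a b y \<longleftrightarrow>
     (\<forall>s t L m. a \<le> s \<longrightarrow> s \<le> t \<longrightarrow> t \<le> b \<longrightarrow> 0 \<le> L \<longrightarrow> 0 \<le> m \<longrightarrow>
        holder_bound \<alpha> L s t y \<longrightarrow> (\<forall>r\<in>{s..t}. norm (y r) \<le> m) \<longrightarrow>
        norm (y t - y s) \<le> \<kappa> * (L + m + \<rho>) * (t - s) powr \<beta>)"

lemma growth_controlledD:
  assumes "growth_controlled \<kappa> \<rho> \<alpha> \<beta> a b y" "a \<le> s" "s \<le> t" "t \<le> b" "0 \<le> L" "0 \<le> m"
    and "holder_bound \<alpha> L s t y" "\<And>r. s \<le> r \<Longrightarrow> r \<le> t \<Longrightarrow> norm (y r) \<le> m"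
  shows "norm (y t - y s) \<le> \<kappa> * (L + m + \<rho>) * (t - s) powr \<beta>"
  using assms by (simp add: growth_controlled_def)

lemma growth_controlled_subinterval:
  assumes "growth_controlled \<kappa> \<rho> \<alpha> \<beta> a b y" "a \<le> a'" "b' \<le> b"
  shows "growth_controlled \<kappa> \<rho> \<alpha> \<beta> a' b' y"
  using assms unfolding growth_controlled_def by (meson order_trans)

text \<open>
The second argument of \<open>min\<close> solves \<open>(4 * \<kappa> + 1) * d powr e = 1\<close>, where the summand \<open>1\<close> admits \<open>\<kappa> = 0\<close>.
The length is capped at \<open>1\<close> so that \<open>d powr \<alpha> \<le> 1\<close> may be used on it.
\<close>

definition step_size :: "real \<Rightarrow> real \<Rightarrow> real" where
  "step_size \<kappa> e = min 1 ((1 / (4 * \<kappa> + 1)) powr (1 / e))"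

lemma step_size_bounds: "0 \<le> \<kappa> \<Longrightarrow> 0 < step_size \<kappa> e" "step_size \<kappa> e \<le> 1"
  by (auto simp: step_size_def)

lemma step_size_small:
  assumes "0 \<le> \<kappa>" "0 < e" "0 \<le> d" "d \<le> step_size \<kappa> e"
  shows "\<kappa> * d powr e \<le> 1/4"
proof -
  have "d powr e \<le> ((1 / (4 * \<kappa> + 1)) powr (1 / e)) powr e"
    using assms by (intro powr_mono2) (auto simp: step_size_def)
  also have "\<dots> = 1 / (4 * \<kappa> + 1)"
    using assms by (simp add: powr_powr)
  finally have "\<kappa> * d powr e \<le> \<kappa> * (1 / (4 * \<kappa> + 1))"
    using assms by (intro mult_left_mono)
  also have "\<dots> \<le> 1/4"
    using assms by (simp add: field_simps)
  finally show ?thesis .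
qed

text \<open>
On a short interval a Hoelder constant \<open>L\<close> bounds \<open>\<bar>y\<bar>\<close> by \<open>\<bar>y a\<bar> + L\<close>, so the controlling inequality turns
\<open>L\<close> into \<open>L/2 + (\<bar>y a\<bar> + \<rho>)/4\<close>. Iterating from the arbitrary \<open>L\<^sub>0\<close> converges to the fixed point
\<open>(\<bar>y a\<bar> + \<rho>)/2\<close>, in which \<open>L\<^sub>0\<close> has disappeared.
\<close>

lemma growth_controlled_short_interval:
  assumes \<alpha>: "0 < \<alpha>" "\<alpha> < \<beta>" and \<kappa>: "0 \<le> \<kappa>" and \<rho>: "0 \<le> \<rho>"
    and ab: "a \<le> b" "b - a \<le> step_size \<kappa> (\<beta> - \<alpha>)"
    and y: "holder_bound \<alpha> L\<^sub>0 a b y" and L0: "0 \<le> L\<^sub>0" and ctrl: "growth_controlled \<kappa> \<rho> \<alpha> \<beta> a b y"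
  shows "holder_bound \<alpha> ((norm (y a) + \<rho>) / 2) a b y" "norm (y b) + \<rho> \<le> 2 * (norm (y a) + \<rho>)"
proof -
  define h where "h = step_size \<kappa> (\<beta> - \<alpha>)"
  have h: "0 < h" "h \<le> 1" and abh: "b - a \<le> h"
    using step_size_bounds \<kappa> ab by (auto simp: h_def)
  have small: "\<kappa> * d powr (\<beta> - \<alpha>) \<le> 1/4" if "0 \<le> d" "d \<le> h" for d
    using that step_size_small[OF \<kappa>, of "\<beta> - \<alpha>"] \<alpha> by (simp add: h_def)
  let ?D = "norm (y a) + \<rho>"
  have iter: "holder_bound \<alpha> (L\<^sub>0 / 2 ^ n + ?D / 2) a b y" for n
  proof (induction n)
    case 0
    then show ?case
      using holder_bound_mono[OF y, of "L\<^sub>0 + ?D / 2"] \<rho> by simp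
  next
    case (Suc n)
    define L where "L = L\<^sub>0 / 2 ^ n + ?D / 2"
    note IH = Suc[folded L_def]
    have L: "0 \<le> L"
      using L0 \<rho> by (simp add: L_def)
    have m: "norm (y r) \<le> norm (y a) + L" if "a \<le> r" "r \<le> b" for r
    proof -
      have "norm (y r - y a) \<le> L * (r - a) powr \<alpha>"
        using that by (intro holder_boundD[OF IH]) auto
      also have "\<dots> \<le> L * 1"
        using that L abh h \<alpha> by (intro mult_left_mono powr_le1) auto
      finally show ?thesis
        using norm_triangle_ineq2[of "y r" "y a"] by argo
    qed
    show ?case
      unfolding holder_bound_def
    proof (intro allI impI)
      fix s t assume st: "a \<le> s" "s \<le> t" "t \<le> b"
      have "norm (y t - y s) \<le> \<kappa> * (L + (norm (y a) + L) + \<rho>) * (t - s) powr \<beta>"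
        using st L m by (intro growth_controlledD[OF ctrl] holder_bound_mono[OF IH]) auto
      also have "\<dots> = (\<kappa> * (t - s) powr (\<beta> - \<alpha>)) * ((2 * L + ?D) * (t - s) powr \<alpha>)"
        by (simp add: powr_diff algebra_simps)
      also have "\<dots> \<le> 1/4 * ((2 * L + ?D) * (t - s) powr \<alpha>)"
        using st abh L \<rho> by (intro mult_right_mono small) auto
      also have "\<dots> = (L\<^sub>0 / 2 ^ Suc n + ?D / 2) * (t - s) powr \<alpha>"
        by (simp add: L_def field_simps)
      finally show "norm (y t - y s) \<le> (L\<^sub>0 / 2 ^ Suc n + ?D / 2) * (t - s) powr \<alpha>" .
    qed
  qed
  show b: "holder_bound \<alpha> (?D / 2) a b y"
    unfolding holder_bound_def
  proof (intro allI impI)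
    fix s t assume st: "a \<le> s" "s \<le> t" "t \<le> b"
    have "(\<lambda>n. (L\<^sub>0 / 2 ^ n + ?D / 2) * (t - s) powr \<alpha>) \<longlonglongrightarrow> (0 + ?D / 2) * (t - s) powr \<alpha>"
      by (intro tendsto_intros LIMSEQ_divide_realpow_zero) auto
    then have "norm (y t - y s) \<le> (0 + ?D / 2) * (t - s) powr \<alpha>"
      using st holder_boundD[OF iter] by (intro LIMSEQ_le_const) auto
    then show "norm (y t - y s) \<le> ?D / 2 * (t - s) powr \<alpha>"
      by simp
  qed
  have "norm (y b - y a) \<le> ?D / 2 * (b - a) powr \<alpha>"
    using ab by (intro holder_boundD[OF b]) auto
  also have "\<dots> \<le> ?D / 2 * 1"
    using ab abh h \<alpha> \<rho> by (intro mult_left_mono powr_le1) auto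
  finally show "norm (y b) + \<rho> \<le> 2 * ?D"
    using norm_triangle_ineq2[of "y b" "y a"] \<rho> norm_ge_zero[of "y a"] by argo
qed

text \<open>
The factor \<open>2\<close> is lost on each of the steps needed to cover an interval of length \<open>T\<close>; \<open>Q\<close> compares
increments over more than one step with the Hoelder modulus of a single step.
\<close>

definition growth_const :: "real \<Rightarrow> real \<Rightarrow> real \<Rightarrow> real \<Rightarrow> real" where
  "growth_const \<kappa> \<alpha> \<beta> T =
     (let h = step_size \<kappa> (\<beta> - \<alpha>); Q = 2 * h powr (- \<alpha>) in 2 ^ nat \<lceil>T / h\<rceil> * (1 + Q + \<kappa> * (Q + 2)))"

lemma growth_const_nonneg: "0 \<le> \<kappa> \<Longrightarrow> 0 \<le> growth_const \<kappa> \<alpha> \<beta> T"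
  by (simp add: growth_const_def Let_def)

text \<open>
\<open>\<bar>y\<bar> + \<rho>\<close> at most doubles on every short interval, which bounds \<open>y\<close> on \<open>[a, b]\<close> and then, short or long
increments separately, its Hoelder constant of order \<open>\<alpha>\<close>. Inserting both bounds into the controlling inequality
once more gives the order \<open>\<beta>\<close>.
\<close>

lemma growth_controlled_global:
  fixes \<alpha> \<beta> \<kappa> T :: real
  assumes \<alpha>: "0 < \<alpha>" "\<alpha> < \<beta>" and \<kappa>: "0 \<le> \<kappa>" and \<rho>: "0 \<le> \<rho>" and ab: "a \<le> b" "b - a \<le> T"
    and L0: "0 \<le> L\<^sub>0" and y: "holder_bound \<alpha> L\<^sub>0 a b y" and ctrl: "growth_controlled \<kappa> \<rho> \<alpha> \<beta> a b y"
  defines "C \<equiv> growth_const \<kappa> \<alpha> \<beta> T"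
  shows "r \<in> {a..b} \<Longrightarrow> norm (y r) \<le> C * (norm (y a) + \<rho>)"
    and "holder_bound \<alpha> (C * (norm (y a) + \<rho>)) a b y" "holder_bound \<beta> (C * (norm (y a) + \<rho>)) a b y"
proof -
  define h where "h = step_size \<kappa> (\<beta> - \<alpha>)"
  have h: "0 < h" "h \<le> 1"
    using step_size_bounds \<kappa> by (auto simp: h_def)
  define N where "N = nat \<lceil>T / h\<rceil>"
  define Q where "Q = 2 * h powr (- \<alpha>)"
  have C_eq: "C = 2 ^ N * (1 + Q + \<kappa> * (Q + 2))"
    by (simp add: C_def growth_const_def Let_def N_def Q_def h_def)
  have "T / h \<le> real N"
    unfolding N_def by (rule real_nat_ceiling_ge)
  then have N: "T \<le> real N * h"
    using h by (simp add: field_simps)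
  have hQ: "1 \<le> h powr (- \<alpha>)"
    using h \<alpha> by (simp add: powr_minus powr_le1 one_le_inverse)
  then have Q: "2 \<le> Q"
    by (simp add: Q_def)
  have C: "2 ^ N \<le> C" "2 ^ N * Q \<le> C" "\<kappa> * (Q + 2) * 2 ^ N \<le> C"
    using Q \<kappa> by (auto simp: C_eq algebra_simps)
  let ?D = "norm (y a) + \<rho>"
  have short: "holder_bound \<alpha> ((norm (y s) + \<rho>) / 2) s t y" "norm (y t) + \<rho> \<le> 2 * (norm (y s) + \<rho>)"
    if "a \<le> s" "s \<le> t" "t \<le> b" "t - s \<le> h" for s t
    by (rule growth_controlled_short_interval[OF \<alpha> \<kappa> \<rho> that(2) that(4)[unfolded h_def] holder_bound_mono[OF y order_refl that(1,3)] L0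
          growth_controlled_subinterval[OF ctrl that(1,3)]]; assumption)+
  have steps: "norm (y r) + \<rho> \<le> 2 ^ n * ?D" if "a \<le> r" "r \<le> b" "r \<le> a + real n * h" for n r
    using that
  proof (induction n arbitrary: r)
    case 0
    then show ?case
      by (metis add.right_neutral antisym mult_zero_left of_nat_0 order_refl power_0 lambda_one)
  next
    case (Suc n)
    show ?case
    proof (cases "r \<le> a + real n * h")
      case True
      have "norm (y r) + \<rho> \<le> 2 ^ n * ?D"
        using Suc True by auto
      also have "\<dots> \<le> 2 ^ Suc n * ?D"
        using \<rho> by (intro mult_right_mono) auto
      finally show ?thesis .
    next
      case False
      let ?s = "a + real n * h"
      have "norm (y r) + \<rho> \<le> 2 * (norm (y ?s) + \<rho>)"
        using False Suc.prems h by (intro short) (auto simp: algebra_simps)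
      also have "\<dots> \<le> 2 * (2 ^ n * ?D)"
        using False Suc.prems h by (intro mult_left_mono Suc.IH) auto
      finally show ?thesis
        by simp
    qed
  qed
  define B where "B = 2 ^ N * ?D"
  have B: "norm (y r) + \<rho> \<le> B" if "a \<le> r" "r \<le> b" for r
    unfolding B_def using that ab N by (intro steps) auto
  have B0: "0 \<le> B" "\<rho> \<le> B"
    using B[of a] ab \<rho> norm_ge_zero[of "y a"] by linarith+
  \<comment> \<open>Increments over more than \<open>h\<close> are bounded by \<open>2 * B\<close>, hence by \<open>Q * B\<close> times the modulus.\<close>
  have \<alpha>_bound: "holder_bound \<alpha> (Q * B) a b y"
    unfolding holder_bound_def
  proof (intro allI impI)
    fix s t assume st: "a \<le> s" "s \<le> t" "t \<le> b"
    show "norm (y t - y s) \<le> Q * B * (t - s) powr \<alpha>"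
    proof (cases "t - s \<le> h")
      case True
      have "norm (y t - y s) \<le> (norm (y s) + \<rho>) / 2 * (t - s) powr \<alpha>"
        using st True by (intro holder_boundD[OF short(1)[of s t]]) auto
      also have "\<dots> \<le> (Q * B) * (t - s) powr \<alpha>"
      proof (rule mult_right_mono)
        have "(norm (y s) + \<rho>) / 2 \<le> 1 * B"
          using B[of s] st B0 by simp
        also have "\<dots> \<le> Q * B"
          using Q B0 by (intro mult_right_mono) auto
        finally show "(norm (y s) + \<rho>) / 2 \<le> Q * B" .
      qed simp
      finally show ?thesis .
    next
      case False
      have "norm (y t - y s) \<le> norm (y t) + norm (y s)"
        by (rule norm_triangle_ineq4)
      also have "\<dots> \<le> 2 * B * 1"
        using B[of s] B[of t] st \<rho> by auto
      also have "2 * B * 1 \<le> 2 * B * (h powr (- \<alpha>) * (t - s) powr \<alpha>)"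
      proof (rule mult_left_mono)
        have "h powr \<alpha> \<le> (t - s) powr \<alpha>"
          using False h \<alpha> by (intro powr_mono2) auto
        then show "1 \<le> h powr (- \<alpha>) * (t - s) powr \<alpha>"
          using h by (simp add: powr_minus field_simps)
      qed (use B0 in simp)
      finally show ?thesis
        by (simp add: Q_def mult_ac)
    qed
  qed
  have \<beta>_bound: "holder_bound \<beta> (\<kappa> * (Q + 2) * B) a b y"
    unfolding holder_bound_def
  proof (intro allI impI)
    fix s t assume st: "a \<le> s" "s \<le> t" "t \<le> b"
    have "norm (y t - y s) \<le> \<kappa> * (Q * B + B + \<rho>) * (t - s) powr \<beta>"
    proof (intro growth_controlledD[OF ctrl st])
      show "norm (y r) \<le> B" if "s \<le> r" "r \<le> t" for r
        using B[of r] that st \<rho> by simp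
    qed (use B0 Q st in \<open>auto intro: holder_bound_mono[OF \<alpha>_bound]\<close>)
    also have "\<dots> \<le> \<kappa> * (Q * B + B + B) * (t - s) powr \<beta>"
      using B0 \<kappa> by (intro mult_right_mono mult_left_mono) auto
    finally show "norm (y t - y s) \<le> \<kappa> * (Q + 2) * B * (t - s) powr \<beta>"
      by (simp add: algebra_simps)
  qed
  have D: "0 \<le> ?D"
    using \<rho> by simp
  show "norm (y r) \<le> C * ?D" if "r \<in> {a..b}"
  proof -
    have "norm (y r) \<le> 2 ^ N * ?D"
      using that B[of r] \<rho> by (auto simp: B_def)
    also have "\<dots> \<le> C * ?D"
      using C D by (intro mult_right_mono)
    finally show "norm (y r) \<le> C * ?D" .
  qed
  show "holder_bound \<alpha> (C * ?D) a b y"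
    using mult_right_mono[OF C(2) D] by (intro holder_bound_mono[OF \<alpha>_bound]) (auto simp: B_def mult_ac)
  show "holder_bound \<beta> (C * ?D) a b y"
    using mult_right_mono[OF C(3) D] by (intro holder_bound_mono[OF \<beta>_bound]) (auto simp: B_def mult_ac)
qed

section \<open>Differences of differences\<close>

lemma norm_derivative_bound:
  fixes F :: "'a::real_normed_vector \<Rightarrow> 'e::real_normed_vector" and D :: "'a \<Rightarrow> 'a \<Rightarrow>\<^sub>L 'e"
  assumes "convex S" "\<And>u. u \<in> S \<Longrightarrow> (F has_derivative blinfun_apply (D u)) (at u)"
    and "\<And>u. u \<in> S \<Longrightarrow> norm (D u) \<le> B" "x \<in> S" "y \<in> S"
  shows "norm (F x - F y) \<le> B * norm (x - y)"
  using assms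
  by (intro differentiable_bound[of S F "\<lambda>u. blinfun_apply (D u)"])
    (auto simp: norm_blinfun.rep_eq[symmetric] intro: has_derivative_at_withinI)

text \<open>
Route from the first difference to the second in three steps. Replacing \<open>F\<close> by \<open>F'\<close> costs the difference
of the derivatives times \<open>\<bar>x - y\<bar>\<close>. Moving \<open>x\<close> to \<open>y + (x' - y')\<close>, a distance equal to the second difference of the points, costs the Lipschitz
constant of \<open>F'\<close>. What is left is the parallelogram difference \<open>(F' (y + d) - F' y) - (F' (y' + d) - F' y')\<close> with
\<open>d = x' - y'\<close>, an increment from \<open>y'\<close> to \<open>y\<close> of a function whose derivative \<open>D' (u + d) - D' u\<close> is at most
\<open>L * norm d\<close>. The fourth corner \<open>y + d\<close> has to lie in \<open>S\<close> as well.
\<close>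

lemma four_point_estimate:
  fixes F F' :: "'a::real_normed_vector \<Rightarrow> 'e::real_normed_vector" and D D' :: "'a \<Rightarrow> 'a \<Rightarrow>\<^sub>L 'e"
  assumes S: "convex S"
    and D: "\<And>u. u \<in> S \<Longrightarrow> (F has_derivative blinfun_apply (D u)) (at u)"
    and D': "\<And>u. u \<in> S \<Longrightarrow> (F' has_derivative blinfun_apply (D' u)) (at u)"
    and \<kappa>: "\<And>u. u \<in> S \<Longrightarrow> norm (D u - D' u) \<le> \<kappa>"
    and L: "\<And>u v. u \<in> S \<Longrightarrow> v \<in> S \<Longrightarrow> norm (D' u - D' v) \<le> L * norm (u - v)"
    and M: "\<And>u v. u \<in> S \<Longrightarrow> v \<in> S \<Longrightarrow> norm (F' u - F' v) \<le> M * norm (u - v)"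
    and pts: "x \<in> S" "y \<in> S" "x' \<in> S" "y' \<in> S" "y + (x' - y') \<in> S"
  shows "norm ((F x - F y) - (F' x' - F' y'))
     \<le> \<kappa> * norm (x - y) + M * norm ((x - y) - (x' - y')) + L * norm (x' - y') * norm (y - y')"
proof -
  let ?d = "x' - y'"
  have 1: "norm ((F x - F' x) - (F y - F' y)) \<le> \<kappa> * norm (x - y)"
    using pts \<kappa> D D'
    by (intro norm_derivative_bound[OF S, of "\<lambda>u. F u - F' u" "\<lambda>u. D u - D' u"])
      (auto simp: blinfun.diff_left intro!: derivative_eq_intros)
  have 2: "norm (F' x - F' (y + ?d)) \<le> M * norm ((x - y) - (x' - y'))"
    using M[of x "y + ?d"] pts by (simp add: algebra_simps)
  have seg: "u \<in> S" "u + ?d \<in> S" if "u \<in> closed_segment y' y" for u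
  proof -
    show "u \<in> S"
      using that pts closed_segment_subset[OF _ _ S] by blast
    have "u + ?d \<in> closed_segment (?d + y') (?d + y)"
      using that closed_segment_translation_eq[of ?d u y' y] by (simp add: add.commute)
    moreover have "closed_segment (?d + y') (?d + y) \<subseteq> S"
      using pts by (intro closed_segment_subset S) (auto simp: algebra_simps)
    ultimately show "u + ?d \<in> S"
      by blast
  qed
  have 3: "norm ((F' (y + ?d) - F' y) - (F' (y' + ?d) - F' y')) \<le> L * norm ?d * norm (y - y')"
  proof (rule norm_derivative_bound[of "closed_segment y' y" "\<lambda>u. F' (u + ?d) - F' u" "\<lambda>u. D' (u + ?d) - D' u"])
    fix u assume u: "u \<in> closed_segment y' y"
    have "((\<lambda>u. F' (u + ?d)) has_derivative blinfun_apply (D' (u + ?d))) (at u)"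
      by (rule has_derivative_compose[of "\<lambda>u. u + ?d" "\<lambda>v. v" u UNIV F', OF _ D'[OF seg(2)[OF u]]])
        (auto intro!: derivative_eq_intros)
    then show "((\<lambda>u. F' (u + ?d) - F' u) has_derivative blinfun_apply (D' (u + ?d) - D' u)) (at u)"
      using has_derivative_diff[OF _ D'[OF seg(1)[OF u]]] by (simp add: blinfun.diff_left[abs_def])
    show "norm (D' (u + ?d) - D' u) \<le> L * norm ?d"
      using L[OF seg(2)[OF u] seg(1)[OF u]] by simp
  qed auto
  have "(F x - F y) - (F' x' - F' y') = ((F x - F' x) - (F y - F' y)) + (F' x - F' (y + ?d))
      + ((F' (y + ?d) - F' y) - (F' (y' + ?d) - F' y'))"
    by simp
  also have "norm \<dots> \<le> \<kappa> * norm (x - y) + M * norm ((x - y) - (x' - y')) + L * norm ?d * norm (y - y')"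
    by (intro norm_triangle_le add_mono 1 2 3)
  finally show ?thesis .
qed

section \<open>Regularity of the coefficient\<close>

text \<open>
The Lipschitz condition in parameter and state and the Hoelder condition in time, joined
into one inequality, with a constant that is uniform for parameters in a ball.
\<close>

definition locally_regular ::
  "real \<Rightarrow> real \<Rightarrow> real \<Rightarrow> real \<Rightarrow>
   (real \<Rightarrow> 'w::real_normed_vector \<Rightarrow> 'x::real_normed_vector \<Rightarrow> 'e::real_normed_vector) \<Rightarrow> bool" where
  "locally_regular \<alpha> T \<rho> K F \<longleftrightarrow>
     (\<forall>s\<in>{0..T}. \<forall>t\<in>{0..T}. \<forall>w\<in>cball 0 \<rho>. \<forall>w'\<in>cball 0 \<rho>. \<forall>x x'.
        norm (F t w x - F s w' x')
          \<le> K * (norm (x - x') + (1 + norm x + norm x') * (norm (w - w') + \<bar>t - s\<bar> powr \<alpha>)))"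

lemma locally_regularD:
  assumes "locally_regular \<alpha> T \<rho> K F" "0 \<le> s" "s \<le> T" "0 \<le> t" "t \<le> T" "norm w \<le> \<rho>" "norm w' \<le> \<rho>"
  shows "norm (F t w x - F s w' x')
    \<le> K * (norm (x - x') + (1 + norm x + norm x') * (norm (w - w') + \<bar>t - s\<bar> powr \<alpha>))"
  using assms by (simp add: locally_regular_def)

lemma continuous_bound_on_compact:
  fixes c :: "'a::topological_space \<Rightarrow> real"
  assumes "continuous_on UNIV c" "compact S"
  shows "\<exists>K\<ge>0. \<forall>z\<in>S. c z \<le> K"
proof -
  have "compact (c ` S)"
    using assms by (intro compact_continuous_image) (auto intro: continuous_on_subset)
  then obtain B where "\<forall>y\<in>c ` S. norm y \<le> B"
    using compact_imp_bounded bounded_iff by metis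
  then show ?thesis
    by (intro exI[of _ "max 0 B"]) (auto simp: abs_le_iff le_max_iff_disj)
qed

text \<open>
The path \<open>(t, w, x) \<rightarrow> (t, w', x') \<rightarrow> (s, w', x')\<close> changes parameter and state at fixed time first.
\<close>

lemma locally_regular_if_lipschitz_time_holder:
  fixes F :: "real \<Rightarrow> 'w::real_normed_vector \<Rightarrow> 'x::real_normed_vector \<Rightarrow> 'e::real_normed_vector"
  assumes 1: "state_param_lipschitz c F" and 2: "time_holder \<alpha> c' F"
    and c: "\<And>z. z \<in> {0..T} \<times> {0..\<rho>} \<times> {0..\<rho>} \<Longrightarrow> c z \<le> K" and c': "\<And>z. z \<in> {0..\<rho>} \<Longrightarrow> c' z \<le> K"
    and K: "0 \<le> K"
  shows "locally_regular \<alpha> T \<rho> K F"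
  unfolding locally_regular_def
proof (intro ballI allI)
  fix s t w w' x x' assume *: "s \<in> {0..T}" "t \<in> {0..T}" "w \<in> cball (0::'w) \<rho>" "w' \<in> cball (0::'w) \<rho>"
  let ?d = "\<bar>t - s\<bar> powr \<alpha>"
  have "norm (F t w x - F t w' x') \<le> c (t, norm w, norm w') * (norm (x - x') + (1 + norm x + norm x') * norm (w - w'))"
    using 1 unfolding state_param_lipschitz_def by blast
  also have "\<dots> \<le> K * (norm (x - x') + (1 + norm x + norm x') * norm (w - w'))"
    using * by (intro mult_right_mono c) auto
  finally have a: "norm (F t w x - F t w' x') \<le> K * (norm (x - x') + (1 + norm x + norm x') * norm (w - w'))" .
  have "norm (F t w' x' - F s w' x') \<le> c' (norm w') * (1 + norm x') * ?d"
    using 2 unfolding time_holder_def by blast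
  also have "\<dots> \<le> K * (1 + norm x + norm x') * ?d"
    using * K by (intro mult_right_mono mult_mono c') auto
  finally have "norm (F t w' x' - F s w' x') \<le> K * (1 + norm x + norm x') * ?d" .
  then show "norm (F t w x - F s w' x') \<le> K * (norm (x - x') + (1 + norm x + norm x') * (norm (w - w') + ?d))"
    using a norm_triangle_ineq[of "F t w x - F t w' x'" "F t w' x' - F s w' x'"] by (simp add: algebra_simps)
qed

text \<open>
The analogue of \<open>locally_regular\<close> for the derivative in the parameter, where the constant is uniform
only for states in a ball, too.
\<close>

definition param_regular ::
  "real \<Rightarrow> real \<Rightarrow> real \<Rightarrow> real \<Rightarrow> real \<Rightarrow>
   (real \<Rightarrow> 'w::real_normed_vector \<Rightarrow> 'x::real_normed_vector \<Rightarrow> 'e::real_normed_vector) \<Rightarrow> bool" where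
  "param_regular \<alpha> T \<rho> B K F \<longleftrightarrow>
     (\<forall>s\<in>{0..T}. \<forall>t\<in>{0..T}. \<forall>w\<in>cball 0 \<rho>. \<forall>w'\<in>cball 0 \<rho>. \<forall>x\<in>cball 0 B. \<forall>x'\<in>cball 0 B.
        norm (F t w x - F s w' x') \<le> K * (norm (x - x') + norm (w - w') + \<bar>t - s\<bar> powr \<alpha>))"

lemma param_regularD:
  assumes "param_regular \<alpha> T \<rho> B K F" "s \<in> {0..T}" "t \<in> {0..T}"
    and "norm w \<le> \<rho>" "norm w' \<le> \<rho>" "norm x \<le> B" "norm x' \<le> B"
  shows "norm (F t w x - F s w' x') \<le> K * (norm (x - x') + norm (w - w') + \<bar>t - s\<bar> powr \<alpha>)"
  using assms by (simp add: param_regular_def)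

lemma param_derivative_regular:
  fixes \<sigma> :: "real \<Rightarrow> 'w::banach \<Rightarrow> 'x::banach \<Rightarrow> ('v::banach \<Rightarrow>\<^sub>L 'x)"
  assumes "nice_in_param \<alpha> \<sigma>"
  shows "\<exists>(D :: real \<Rightarrow> 'w \<Rightarrow> 'x \<Rightarrow> ('w \<Rightarrow>\<^sub>L ('v \<Rightarrow>\<^sub>L 'x))) K. 0 \<le> K \<and> param_regular \<alpha> T \<rho> B K D \<and>
    (\<forall>t w x. ((\<lambda>u. \<sigma> t u x) has_derivative blinfun_apply (D t w x)) (at w))"
proof -
  obtain D c c' where D: "\<And>t w x. ((\<lambda>u. \<sigma> t u x) has_derivative blinfun_apply (D t w x)) (at w)"
    and c: "continuous_on UNIV c" "\<And>t w w' x x'. norm (D t w x - D t w' x')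
        \<le> c (t, norm w, norm w', norm x, norm x') * (norm (x - x') + norm (w - w'))"
    and c': "continuous_on UNIV c'" "\<And>t s w x. norm (D t w x - D s w x) \<le> c' (norm w, norm x) * \<bar>t - s\<bar> powr \<alpha>"
    using assms unfolding nice_in_param_def by blast
  let ?S = "{0..T} \<times> {0..\<rho>} \<times> {0..\<rho>} \<times> {0..B} \<times> {0..B}"
  obtain K where K: "0 \<le> K" "\<forall>z\<in>?S. c z \<le> K"
    using continuous_bound_on_compact[OF c(1) compact_Times[OF compact_Icc compact_Times[OF compact_Icc compact_Times[OF compact_Icc compact_Times[OF compact_Icc compact_Icc]]]]] by blast
  obtain K' where K': "0 \<le> K'" "\<forall>z\<in>{0..\<rho>} \<times> {0..B}. c' z \<le> K'"
    using continuous_bound_on_compact[OF c'(1) compact_Times[OF compact_Icc compact_Icc]] by blast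
  have "norm (D t w x - D s w' x') \<le> (K + K') * (norm (x - x') + norm (w - w') + \<bar>t - s\<bar> powr \<alpha>)"
    if *: "s \<in> {0..T}" "t \<in> {0..T}" "norm w \<le> \<rho>" "norm w' \<le> \<rho>" "norm x \<le> B" "norm x' \<le> B" for s t w w' x x'
  proof -
    let ?e = "norm (x - x') + norm (w - w')" and ?d = "\<bar>t - s\<bar> powr \<alpha>"
    have "norm (D t w x - D t w' x') \<le> c (t, norm w, norm w', norm x, norm x') * ?e"
      by (rule c(2))
    also have "\<dots> \<le> K * ?e"
      using * by (intro mult_right_mono K(2)[rule_format]) auto
    finally have 1: "norm (D t w x - D t w' x') \<le> K * ?e" .
    have "norm (D t w' x' - D s w' x') \<le> c' (norm w', norm x') * ?d"
      by (rule c'(2))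
    also have "\<dots> \<le> K' * ?d"
      using * by (intro mult_right_mono K'(2)[rule_format]) auto
    finally have "norm (D t w x - D s w' x') \<le> K * ?e + K' * ?d"
      using 1 norm_triangle_ineq[of "D t w x - D t w' x'" "D t w' x' - D s w' x'"] by simp
    also have "\<dots> \<le> (K + K') * ?e + (K + K') * ?d"
      using K K' by (intro add_mono mult_right_mono) auto
    finally show ?thesis
      by (simp add: algebra_simps)
  qed
  then have "param_regular \<alpha> T \<rho> B (K + K') D"
    by (simp add: param_regular_def)
  moreover have "0 \<le> K + K'"
    using K K' by simp
  ultimately show ?thesis
    using D by blast
qed

text \<open>
A coefficient whose constants have been made uniform for a given radius \<open>R\<close>, which bounds both the
driver and the parameter path. Regularity is required for parameters of norm up to \<open>3 * R\<close> because the fourth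
corner \<open>w' t + (w s - w' s)\<close> in the four point estimate may leave the ball of radius \<open>R\<close>.
\<close>

locale young_coefficient =
  fixes \<sigma> :: "real \<Rightarrow> 'w::banach \<Rightarrow> 'x::banach \<Rightarrow> ('v::banach \<Rightarrow>\<^sub>L 'x)"
    and D :: "real \<Rightarrow> 'w \<Rightarrow> 'x \<Rightarrow> ('x \<Rightarrow>\<^sub>L ('v \<Rightarrow>\<^sub>L 'x))"
    and \<alpha> \<beta> T R K :: real
  assumes T: "0 < T" and \<alpha>: "1/2 < \<alpha>" "\<alpha> < \<beta>" and R: "0 < R" and K: "0 < K"
    and bounded: "norm (\<sigma> t w x) \<le> K"
    and derivative: "(\<sigma> t w has_derivative blinfun_apply (D t w x)) (at x)"
    and regular: "locally_regular \<alpha> T (3 * R) K \<sigma>" "locally_regular \<alpha> T (3 * R) K D"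

lemma young_coefficient_if_nice:
  fixes \<sigma> :: "real \<Rightarrow> 'w::banach \<Rightarrow> 'x::banach \<Rightarrow> ('v::banach \<Rightarrow>\<^sub>L 'x)"
  assumes nice: "nice_function \<alpha> \<sigma>" and par: "0 < T" "1/2 < \<alpha>" "\<alpha> < \<beta>" "0 < R"
  obtains D K where "young_coefficient \<sigma> D \<alpha> \<beta> T R K"
proof -
  obtain M D c c' where M: "\<And>t w x. norm (\<sigma> t w x) \<le> M"
    and D: "\<And>t w x. (\<sigma> t w has_derivative blinfun_apply (D t w x)) (at x)"
    and c: "continuous_on UNIV c" "state_param_lipschitz c \<sigma>" "state_param_lipschitz c D"
    and c': "continuous_on UNIV c'" "time_holder \<alpha> c' \<sigma>" "time_holder \<alpha> c' D"
    using nice unfolding nice_function_def by blast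
  obtain K where K: "0 \<le> K" "\<forall>z\<in>{0..T} \<times> {0..3 * R} \<times> {0..3 * R}. c z \<le> K"
    using continuous_bound_on_compact[OF c(1) compact_Times[OF compact_Icc compact_Times[OF compact_Icc compact_Icc]]] by blast
  obtain K' where K': "0 \<le> K'" "\<forall>z\<in>{0..3 * R}. c' z \<le> K'"
    using continuous_bound_on_compact[OF c'(1) compact_Icc] by blast
  let ?K = "max M (max K (max K' 1))"
  have cK: "c z \<le> ?K" if "z \<in> {0..T} \<times> {0..3 * R} \<times> {0..3 * R}" for z
    using bspec[OF K(2) that] by simp
  have cK': "c' z \<le> ?K" if "z \<in> {0..3 * R}" for z
    using bspec[OF K'(2) that] by simp
  have "locally_regular \<alpha> T (3 * R) ?K \<sigma>"
    by (rule locally_regular_if_lipschitz_time_holder[OF c(2) c'(2) cK cK']) auto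
  moreover have "locally_regular \<alpha> T (3 * R) ?K D"
    by (rule locally_regular_if_lipschitz_time_holder[OF c(3) c'(3) cK cK']) auto
  ultimately have "young_coefficient \<sigma> D \<alpha> \<beta> T R ?K"
    using par D M by unfold_locales (auto simp: le_max_iff_disj)
  then show ?thesis
    by (rule that)
qed

section \<open>Growth of Young integrals along paths\<close>

context young_coefficient begin

lemma exponents_gt_1: "1 < \<alpha> + \<beta>"
  using \<alpha> by simp

lemma \<alpha>_pos: "0 < \<alpha>"
  using \<alpha> by simp

abbreviation "sew \<equiv> sewing_const (\<alpha> + \<beta>) * T powr \<alpha>"

lemma sew_nonneg: "0 \<le> sew"
  using sewing_const_pos[OF exponents_gt_1] by simp

abbreviation "coefficient w x \<equiv> \<lambda>r. \<sigma> r (w r) (x r)"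

definition admissible :: "(real \<Rightarrow> 'v) \<Rightarrow> (real \<Rightarrow> 'w) \<Rightarrow> bool" where
  "admissible g w \<longleftrightarrow> holder_bound \<beta> R 0 T g \<and> holder_ball \<alpha> R R 0 T w"

lemma admissibleD:
  assumes "admissible g w" "0 \<le> a" "b \<le> T"
  shows "holder_bound \<beta> R a b g" "holder_ball \<alpha> R R a b w"
  using assms by (auto simp: admissible_def intro: holder_bound_mono holder_ball_subinterval)

lemma admissibleI:
  assumes "holder_seminorm \<beta> {0..T} g \<le> ennreal R" "holder_norm \<alpha> {0..T} w \<le> ennreal R"
  shows "admissible g w"
  using assms R holder_norm_leD[OF assms(2)] by (auto simp: admissible_def holder_ball_def holder_seminorm_le_iff)

text \<open>
The bound is affine in \<open>L\<close> and \<open>m\<close>; this linear growth keeps the step length in the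
continuation argument independent of the size of the solution.
\<close>

lemma coefficient_holder_bound:
  assumes ab: "0 \<le> a" "b \<le> T" and w: "holder_ball \<alpha> R R a b w"
    and x: "holder_ball \<alpha> L m a b x" and m: "0 \<le> m"
  shows "holder_bound \<alpha> (K * (L + (1 + 2 * m) * (R + 1))) a b (\<lambda>r. \<sigma> r (w r) (x r))"
  unfolding holder_bound_def
proof (intro allI impI)
  fix s t assume st: "a \<le> s" "s \<le> t" "t \<le> b"
  have bounds: "norm (w s) \<le> R" "norm (w t) \<le> R" "norm (x s) \<le> m" "norm (x t) \<le> m"
    using st by (auto intro!: holder_ballD(2)[OF w] holder_ballD(2)[OF x])
  have "norm (\<sigma> t (w t) (x t) - \<sigma> s (w s) (x s))
     \<le> K * (norm (x t - x s) + (1 + norm (x t) + norm (x s)) * (norm (w t - w s) + \<bar>t - s\<bar> powr \<alpha>))"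
    using st ab R bounds by (intro locally_regularD[OF regular(1)]) auto
  also have "\<dots> \<le> K * (L * (t - s) powr \<alpha> + (1 + m + m) * (R * (t - s) powr \<alpha> + (t - s) powr \<alpha>))"
    using K R st m bounds holder_ballD(1)[OF x st] holder_ballD(1)[OF w st]
    by (intro mult_left_mono add_mono mult_mono) auto
  finally show "norm (\<sigma> t (w t) (x t) - \<sigma> s (w s) (x s)) \<le> K * (L + (1 + 2 * m) * (R + 1)) * (t - s) powr \<alpha>"
    by (simp add: algebra_simps)
qed

lemma coefficient_germ_almost_additive:
  assumes gw: "admissible g w" and ab: "0 \<le> a" "b \<le> T" "a \<le> b" and x: "holder_ball \<alpha> L m a b x" and L: "0 \<le> L"
  shows "almost_additive (\<alpha> + \<beta>) (K * (L + (1 + 2 * m) * (R + 1)) * R) a b (young_germ (coefficient w x) g)"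
  using holder_ball_nonneg[OF x ab(3)] L K R \<alpha> admissibleD[OF gw ab(1,2)]
  by (intro young_germ_almost_additive coefficient_holder_bound[OF ab(1,2) _ x]) auto

definition growth_rate :: real where
  "growth_rate = (sew + 1) * (2 * K * (R + 1) * R)"

lemma growth_rate_nonneg: "0 \<le> growth_rate"
  using sew_nonneg K R by (simp add: growth_rate_def)

text \<open>
The a priori estimate in the form required by \<open>growth_controlled\<close>, with \<open>\<rho> = 1\<close>.
The integrator \<open>Y\<close> is kept apart from \<open>x\<close> so that the estimate also applies to one Picard
step.
\<close>

lemma integral_growth:
  assumes ab: "0 \<le> a" "a \<le> b" "b \<le> T" and g: "holder_bound \<beta> R a b g" and w: "holder_ball \<alpha> R R a b w"
    and x: "holder_ball \<alpha> L m a b x" and L: "0 \<le> L"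
    and Y: "sewn (\<alpha> + \<beta>) C a b (young_germ (\<lambda>r. \<sigma> r (w r) (x r)) g) Y"
  shows "norm (Y b - Y a) \<le> growth_rate * (L + m + 1) * (b - a) powr \<beta>"
proof -
  let ?H = "K * (L + (1 + 2 * m) * (R + 1))"
  have m: "0 \<le> m"
    using holder_ball_nonneg[OF x ab(2)] .
  have H: "0 \<le> ?H"
    using K L m R by simp
  have "norm (Y b - Y a) \<le> (sew * (?H * R) + K * R) * (b - a) powr \<beta>"
  proof (rule sewn_increment_bound[OF exponents_gt_1 _ _ _ Y])
    show "almost_additive (\<alpha> + \<beta>) (?H * R) a b (young_germ (\<lambda>r. \<sigma> r (w r) (x r)) g)"
      using ab \<alpha> R H by (intro young_germ_almost_additive coefficient_holder_bound[OF _ _ w x m] g) auto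
    show "norm (young_germ (\<lambda>r. \<sigma> r (w r) (x r)) g a b) \<le> K * R * (b - a) powr \<beta>"
      using K ab by (intro young_germ_bound[OF bounded g]) auto
  qed (use \<alpha> H R ab in auto)
  also have "\<dots> \<le> (growth_rate * (L + m + 1)) * (b - a) powr \<beta>"
  proof (rule mult_right_mono)
    have "L + (1 + 2 * m) * (R + 1) \<le> 2 * (R + 1) * (L + m + 1)"
      using L m R mult_nonneg_nonneg[of L R] by (simp add: algebra_simps)
    then have "?H * R \<le> K * (2 * (R + 1) * (L + m + 1)) * R"
      using K R by (intro mult_right_mono mult_left_mono) auto
    moreover have "1 * (K * R) \<le> (2 * (R + 1) * (L + m + 1)) * (K * R)"
      using L m R K mult_mono[of 1 "2 * (R + 1)" 1 "L + m + 1"] by (intro mult_right_mono) auto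
    ultimately have "sew * (?H * R) + K * R \<le> sew * (K * (2 * (R + 1) * (L + m + 1)) * R) + (2 * (R + 1) * (L + m + 1)) * (K * R)"
      by (intro add_mono mult_left_mono sew_nonneg) auto
    also have "\<dots> = growth_rate * (L + m + 1)"
      by (simp add: growth_rate_def algebra_simps)
    finally show "sew * (?H * R) + K * R \<le> growth_rate * (L + m + 1)" .
  qed simp
  finally show ?thesis .
qed

definition state_lip :: "real \<Rightarrow> real" where
  "state_lip B = K * (1 + (1 + 6 * B) * (R + 1) + B)"

lemma state_lip_ge:
  assumes "0 \<le> B"
  shows "K \<le> state_lip B"
proof -
  have "K * 1 \<le> state_lip B"
    unfolding state_lip_def using assms K R by (intro mult_left_mono) auto
  then show ?thesis by simp
qed

text \<open>
The four point estimate for \<open>F = \<sigma> t (w t)\<close> and \<open>F' = \<sigma> s (w s)\<close>. The result is linear in the size of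
\<open>x - y\<close>; the Hoelder constant of \<open>y\<close> enters only the factor.
\<close>

lemma state_difference_holder:
  assumes ab: "0 \<le> a" "a \<le> b" "b \<le> T" and w: "holder_ball \<alpha> R R a b w"
    and x: "holder_ball \<alpha> B B a b x" and y: "holder_ball \<alpha> B B a b y"
    and z: "holder_ball \<alpha> L m a b (\<lambda>r. x r - y r)" and L: "0 \<le> L"
  shows "holder_ball \<alpha> (state_lip B * (L + m)) (state_lip B * (L + m)) a b
           (\<lambda>r. \<sigma> r (w r) (x r) - \<sigma> r (w r) (y r))"
proof -
  have B: "0 \<le> B" and m: "0 \<le> m"
    using holder_ball_nonneg[OF x ab(2)] holder_ball_nonneg[OF z ab(2)] .
  have Lip: "norm (\<sigma> r (w r) u - \<sigma> r (w r) v) \<le> K * norm (u - v)" if "a \<le> r" "r \<le> b" for r u v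
    using locally_regularD[OF regular(1), of r r "w r" "w r" u v] that ab R holder_ballD(2)[OF w, of r] by simp
  have DLip: "norm (D r (w r) u - D r (w r) v) \<le> K * norm (u - v)" if "a \<le> r" "r \<le> b" for r u v
    using locally_regularD[OF regular(2), of r r "w r" "w r" u v] that ab R holder_ballD(2)[OF w, of r] by simp
  show ?thesis
    unfolding holder_ball_def
  proof (intro conjI ballI)
    show "holder_bound \<alpha> (state_lip B * (L + m)) a b (\<lambda>r. \<sigma> r (w r) (x r) - \<sigma> r (w r) (y r))"
      unfolding holder_bound_def
    proof (intro allI impI)
      fix s t assume st: "a \<le> s" "s \<le> t" "t \<le> b"
      let ?\<kappa> = "K * ((1 + 6 * B) * ((R + 1) * (t - s) powr \<alpha>))"
      have w_le: "norm (w s) \<le> 3 * R" "norm (w t) \<le> 3 * R"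
        using holder_ballD(2)[OF w, of s] holder_ballD(2)[OF w, of t] st R by auto
      have xy: "norm (x s) \<le> B" "norm (x t) \<le> B" "norm (y s) \<le> B" "norm (y t) \<le> B"
        using st by (auto intro!: holder_ballD(2)[OF x] holder_ballD(2)[OF y])
      have Dt: "norm (D t (w t) u - D s (w s) u) \<le> ?\<kappa>" if "u \<in> cball 0 (3 * B)" for u
      proof -
        have "norm (D t (w t) u - D s (w s) u)
           \<le> K * (norm (u - u) + (1 + norm u + norm u) * (norm (w t - w s) + \<bar>t - s\<bar> powr \<alpha>))"
          using st ab w_le by (intro locally_regularD[OF regular(2)]) auto
        also have "\<dots> \<le> K * (0 + (1 + 3 * B + 3 * B) * (R * (t - s) powr \<alpha> + (t - s) powr \<alpha>))"
          using K B that st holder_ballD(1)[OF w st] by (intro mult_left_mono add_mono mult_mono) auto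
        finally show ?thesis
          by (simp add: algebra_simps)
      qed
      \<comment> \<open>The fourth corner is why the derivatives are compared on the ball of radius \<open>3 * B\<close>.\<close>
      have "y t + (x s - y s) \<in> cball 0 (3 * B)"
        using norm_triangle_ineq[of "y t" "x s - y s"] norm_triangle_ineq4[of "x s" "y s"] xy by simp
      then have "norm ((\<sigma> t (w t) (x t) - \<sigma> t (w t) (y t)) - (\<sigma> s (w s) (x s) - \<sigma> s (w s) (y s)))
          \<le> ?\<kappa> * norm (x t - y t) + K * norm ((x t - y t) - (x s - y s)) + K * norm (x s - y s) * norm (y t - y s)"
        using st xy B
        by (intro four_point_estimate[of "cball 0 (3 * B)" _ "D t (w t)" _ "D s (w s)"] derivative Lip DLip Dt) auto
      also have "\<dots> \<le> ?\<kappa> * m + K * (L * (t - s) powr \<alpha>) + K * m * (B * (t - s) powr \<alpha>)"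
        using st K B R m holder_ballD(1)[OF z st] holder_ballD(2)[OF z, of s] holder_ballD(2)[OF z, of t] holder_ballD(1)[OF y st]
        by (intro add_mono mult_mono mult_nonneg_nonneg) auto
      also have "\<dots> = K * ((1 + 6 * B) * (R + 1) * m + L + B * m) * (t - s) powr \<alpha>"
        by (simp add: algebra_simps)
      also have "\<dots> \<le> state_lip B * (L + m) * (t - s) powr \<alpha>"
      proof (rule mult_right_mono)
        have "(1 + 6 * B) * (R + 1) * m + L + B * m \<le> (1 + (1 + 6 * B) * (R + 1) + B) * (L + m)"
          using B R L m mult_nonneg_nonneg[of "(1 + 6 * B) * (R + 1)" L] mult_nonneg_nonneg[of B L] 
          by (simp add: algebra_simps)
        then have "K * ((1 + 6 * B) * (R + 1) * m + L + B * m) \<le> K * ((1 + (1 + 6 * B) * (R + 1) + B) * (L + m))"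
          using K by (intro mult_left_mono) auto
        then show "K * ((1 + 6 * B) * (R + 1) * m + L + B * m) \<le> state_lip B * (L + m)"
          by (simp add: state_lip_def mult.assoc)
      qed simp
      finally show "norm ((\<sigma> t (w t) (x t) - \<sigma> t (w t) (y t)) - (\<sigma> s (w s) (x s) - \<sigma> s (w s) (y s)))
          \<le> state_lip B * (L + m) * (t - s) powr \<alpha>" .
    qed
  next
    fix r assume r: "r \<in> {a..b}"
    have "norm (\<sigma> r (w r) (x r) - \<sigma> r (w r) (y r)) \<le> K * norm (x r - y r)"
      using r by (intro Lip) auto
    also have "\<dots> \<le> state_lip B * (L + m)"
      using state_lip_ge[OF B] K L m r holder_ballD(2)[OF z, of r] by (intro mult_mono) auto
    finally show "norm (\<sigma> r (w r) (x r) - \<sigma> r (w r) (y r)) \<le> state_lip B * (L + m)" .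
  qed
qed

text \<open>
The four point estimate in the parameter variable, for \<open>F = (\<lambda>u. \<sigma> t u (y t))\<close> and
\<open>F' = (\<lambda>u. \<sigma> s u (y s))\<close>.
\<close>

lemma param_difference_holder:
  fixes E :: "real \<Rightarrow> 'w \<Rightarrow> 'x \<Rightarrow> ('w \<Rightarrow>\<^sub>L ('v \<Rightarrow>\<^sub>L 'x))"
  assumes E: "\<And>t w x. ((\<lambda>u. \<sigma> t u x) has_derivative blinfun_apply (E t w x)) (at w)"
    and E_reg: "param_regular \<alpha> T (3 * R) B K' E"
    and K': "0 \<le> K'" and ab: "0 \<le> a" "a \<le> b" "b \<le> T"
    and w: "holder_ball \<alpha> R R a b w" and w': "holder_ball \<alpha> R R a b w'" and y: "holder_ball \<alpha> B B a b y"
    and d: "holder_ball \<alpha> N N a b (\<lambda>r. w r - w' r)"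
  defines "Q \<equiv> (K' * (B + 1) + K * (1 + 2 * B) + K' * R) * N"
  shows "holder_ball \<alpha> Q Q a b (\<lambda>r. \<sigma> r (w r) (y r) - \<sigma> r (w' r) (y r))"
proof -
  have nn: "0 \<le> B" "0 \<le> N"
    using holder_ball_nonneg[OF y ab(2)] holder_ball_nonneg[OF d ab(2)] .
  have Lip: "norm (\<sigma> r u (y r) - \<sigma> r v (y r)) \<le> K * (1 + 2 * B) * norm (u - v)"
    if "a \<le> r" "r \<le> b" "norm u \<le> 3 * R" "norm v \<le> 3 * R" for r u v
  proof -
    have "norm (\<sigma> r u (y r) - \<sigma> r v (y r)) \<le> K * (norm (y r - y r) + (1 + norm (y r) + norm (y r)) * (norm (u - v) + \<bar>r - r\<bar> powr \<alpha>))"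
      using that ab by (intro locally_regularD[OF regular(1)]) auto
    also have "\<dots> \<le> K * (0 + (1 + B + B) * (norm (u - v) + 0))"
      using K nn that holder_ballD(2)[OF y, of r] by (intro mult_left_mono add_mono mult_mono) auto
    finally show ?thesis
      by (simp add: algebra_simps)
  qed
  show ?thesis
    unfolding holder_ball_def
  proof (intro conjI ballI)
    show "holder_bound \<alpha> Q a b (\<lambda>r. \<sigma> r (w r) (y r) - \<sigma> r (w' r) (y r))"
      unfolding holder_bound_def
    proof (intro allI impI)
      fix s t assume st: "a \<le> s" "s \<le> t" "t \<le> b"
      let ?h = "(t - s) powr \<alpha>"
      have le: "norm (w s) \<le> R" "norm (w t) \<le> R" "norm (w' s) \<le> R" "norm (w' t) \<le> R" "norm (y s) \<le> B" "norm (y t) \<le> B"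
        using st by (auto intro!: holder_ballD(2)[OF w] holder_ballD(2)[OF w'] holder_ballD(2)[OF y])
      have T: "s \<in> {0..T}" "t \<in> {0..T}"
        using st ab by auto
      have 1: "norm (E t u (y t) - E s u (y s)) \<le> K' * ((B + 1) * ?h)" if "u \<in> cball 0 (3 * R)" for u
      proof -
        have "norm (E t u (y t) - E s u (y s)) \<le> K' * (norm (y t - y s) + norm (u - u) + \<bar>t - s\<bar> powr \<alpha>)"
          using that le T by (intro param_regularD[OF E_reg]) auto
        also have "\<dots> \<le> K' * (B * ?h + 0 + ?h)"
          using K' st holder_ballD(1)[OF y st] by (intro mult_left_mono add_mono) auto
        finally show ?thesis
          by (simp add: algebra_simps)
      qed
      have 2: "norm (E s u (y s) - E s v (y s)) \<le> K' * norm (u - v)" if "u \<in> cball 0 (3 * R)" "v \<in> cball 0 (3 * R)" for u v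
        using param_regularD[OF E_reg, of s s u v "y s" "y s"] that le T by simp
      have "w' t + (w s - w' s) \<in> cball 0 (3 * R)"
        using norm_triangle_ineq[of "w' t" "w s - w' s"] norm_triangle_ineq4[of "w s" "w' s"] le by simp
      then have "norm ((\<sigma> t (w t) (y t) - \<sigma> t (w' t) (y t)) - (\<sigma> s (w s) (y s) - \<sigma> s (w' s) (y s)))
          \<le> K' * ((B + 1) * ?h) * norm (w t - w' t) + K * (1 + 2 * B) * norm ((w t - w' t) - (w s - w' s))
            + K' * norm (w s - w' s) * norm (w' t - w' s)"
        using st le R E 1 2 Lip
        by (intro four_point_estimate[of "cball 0 (3 * R)" "\<lambda>u. \<sigma> t u (y t)" "\<lambda>u. E t u (y t)" "\<lambda>u. \<sigma> s u (y s)" "\<lambda>u. E s u (y s)"])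
          auto
      also have "\<dots> \<le> K' * ((B + 1) * ?h) * N + K * (1 + 2 * B) * (N * ?h) + K' * N * (R * ?h)"
        using st K K' R nn holder_ballD(1)[OF d st] holder_ballD(2)[OF d, of s] holder_ballD(2)[OF d, of t] holder_ballD(1)[OF w' st]
        by (intro add_mono mult_mono mult_nonneg_nonneg) auto
      finally show "norm ((\<sigma> t (w t) (y t) - \<sigma> t (w' t) (y t)) - (\<sigma> s (w s) (y s) - \<sigma> s (w' s) (y s))) \<le> Q * ?h"
        by (simp add: Q_def algebra_simps)
    qed
  next
    fix r assume r: "r \<in> {a..b}"
    have "norm (\<sigma> r (w r) (y r) - \<sigma> r (w' r) (y r)) \<le> K * (1 + 2 * B) * norm (w r - w' r)"
      using r R holder_ballD(2)[OF w, of r] holder_ballD(2)[OF w', of r] by (intro Lip) auto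
    also have "\<dots> \<le> K * (1 + 2 * B) * N"
      using r K nn holder_ballD(2)[OF d, of r] by (intro mult_left_mono) auto
    also have "\<dots> \<le> Q"
      unfolding Q_def using nn K K' R by (intro mult_right_mono) auto
    finally show "norm (\<sigma> r (w r) (y r) - \<sigma> r (w' r) (y r)) \<le> Q" .
  qed
qed

lemma param_difference_const:
  assumes B: "0 \<le> B" and nice: "nice_in_param \<alpha> \<sigma>"
  obtains P where "0 \<le> P" and "\<forall>w w' y N a b. 0 \<le> a \<longrightarrow> a \<le> b \<longrightarrow> b \<le> T \<longrightarrow>
     holder_ball \<alpha> R R a b w \<longrightarrow> holder_ball \<alpha> R R a b w' \<longrightarrow> holder_ball \<alpha> B B a b y \<longrightarrow>
     holder_ball \<alpha> N N a b (\<lambda>r. w r - w' r) \<longrightarrow>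
     holder_ball \<alpha> (P * N) (P * N) a b (\<lambda>r. \<sigma> r (w r) (y r) - \<sigma> r (w' r) (y r))"
proof -
  obtain E K' where E: "0 \<le> K'" "param_regular \<alpha> T (3 * R) B K' E"
    and deriv: "\<forall>t w x. ((\<lambda>u. \<sigma> t u x) has_derivative blinfun_apply (E t w x)) (at w)"
    using param_derivative_regular[OF nice, of T "3 * R" B] by blast
  show thesis
  proof (rule that[of "K' * (B + 1) + K * (1 + 2 * B) + K' * R"])
    show "0 \<le> K' * (B + 1) + K * (1 + 2 * B) + K' * R"
      using E(1) K R B by (intro add_nonneg_nonneg mult_nonneg_nonneg) auto
  qed (intro allI impI param_difference_holder[OF deriv[rule_format] E(2,1)])
qed

definition stability_rate :: "real \<Rightarrow> real" where
  "stability_rate B = (sew + 1) * ((state_lip B + 1) * R + K * (B + (1 + 2 * B) * (R + 1) + 1))"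

lemma stability_rate_nonneg: "0 \<le> B \<Longrightarrow> 0 \<le> stability_rate B"
  using sew_nonneg K R state_lip_ge[of B] by (simp add: stability_rate_def)

text \<open>
The difference of the two germs splits as \<open>p g + q g + f (g - g')\<close>, where \<open>p\<close> is the coefficient
difference caused by the states, \<open>q\<close> that caused by the parameters and \<open>f\<close> is the coefficient of the second
equation. Only \<open>p\<close> involves \<open>x - y\<close>; the other two terms are inhomogeneities of size \<open>Q\<close> and \<open>\<eta>\<close>.
\<close>

lemma integral_difference_growth:
  assumes ab: "0 \<le> a" "a \<le> b" "b \<le> T"
    and g: "holder_bound \<beta> R a b g" and g': "holder_bound \<beta> R a b g'"
    and g_diff: "holder_bound \<beta> \<eta> a b (\<lambda>r. g r - g' r)" and \<eta>: "0 \<le> \<eta>"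
    and w: "holder_ball \<alpha> R R a b w" and w': "holder_ball \<alpha> R R a b w'"
    and x: "holder_ball \<alpha> B B a b x" and y: "holder_ball \<alpha> B B a b y"
    and w_diff: "holder_ball \<alpha> Q Q a b (\<lambda>r. \<sigma> r (w r) (y r) - \<sigma> r (w' r) (y r))"
    and z: "holder_ball \<alpha> L m a b (\<lambda>r. x r - y r)" and L: "0 \<le> L"
    and X: "sewn (\<alpha> + \<beta>) C a b (young_germ (\<lambda>r. \<sigma> r (w r) (x r)) g) X"
    and Y: "sewn (\<alpha> + \<beta>) C' a b (young_germ (\<lambda>r. \<sigma> r (w' r) (y r)) g') Y"
  shows "norm ((X b - Y b) - (X a - Y a)) \<le> stability_rate B * (L + m + (Q + \<eta>)) * (b - a) powr \<beta>"
proof -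
  define p where "p r = \<sigma> r (w r) (x r) - \<sigma> r (w r) (y r)" for r
  define q where "q r = \<sigma> r (w r) (y r) - \<sigma> r (w' r) (y r)" for r
  define f where "f r = \<sigma> r (w' r) (y r)" for r
  define g\<^sub>d where "g\<^sub>d r = g r - g' r" for r
  have nn: "0 \<le> B" "0 \<le> m" "0 \<le> Q"
    using holder_ball_nonneg[OF x ab(2)] holder_ball_nonneg[OF z ab(2)] holder_ball_nonneg[OF w_diff ab(2)] .
  let ?P = "state_lip B * (L + m)" and ?F = "K * (B + (1 + 2 * B) * (R + 1))"
  have P: "0 \<le> ?P" and F: "0 \<le> ?F"
    using nn L R K state_lip_ge[of B] by auto
  have p: "holder_ball \<alpha> ?P ?P a b p"
    unfolding p_def by (rule state_difference_holder[OF ab w x y z L])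
  have q: "holder_ball \<alpha> Q Q a b q"
    using w_diff by (simp add: q_def[abs_def])
  have f: "holder_bound \<alpha> ?F a b f"
    unfolding f_def using ab nn by (intro coefficient_holder_bound[OF _ _ w' y]) auto
  have gd: "holder_bound \<beta> \<eta> a b g\<^sub>d"
    using g_diff by (simp add: g\<^sub>d_def[abs_def])
  let ?A = "\<lambda>s t. young_germ p g s t + young_germ q g s t + young_germ f g\<^sub>d s t"
  have A: "?A = (\<lambda>s t. young_germ (\<lambda>r. \<sigma> r (w r) (x r)) g s t - young_germ (\<lambda>r. \<sigma> r (w' r) (y r)) g' s t)"
    by (intro ext) (simp add: young_germ_def p_def q_def f_def g\<^sub>d_def blinfun.bilinear_simps)
  let ?c = "?P * R + Q * R + ?F * \<eta>"
  have add: "almost_additive (\<alpha> + \<beta>) (?P * R) a b (young_germ p g)"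
    "almost_additive (\<alpha> + \<beta>) (Q * R) a b (young_germ q g)"
    "almost_additive (\<alpha> + \<beta>) (?F * \<eta>) a b (young_germ f g\<^sub>d)"
    using p q \<alpha> R P F nn \<eta> by (auto intro!: young_germ_almost_additive f g gd simp: holder_ball_def)
  have "almost_additive (\<alpha> + \<beta>) ?c a b ?A"
    unfolding almost_additive_def
  proof (intro allI impI)
    fix s u t assume o: "a \<le> s" "s \<le> u" "u \<le> t" "t \<le> b"
    have "?A s t - ?A s u - ?A u t = (young_germ p g s t - young_germ p g s u - young_germ p g u t)
       + (young_germ q g s t - young_germ q g s u - young_germ q g u t)
       + (young_germ f g\<^sub>d s t - young_germ f g\<^sub>d s u - young_germ f g\<^sub>d u t)"
      by simp
    also have "norm \<dots> \<le> ?P * R * (t - s) powr (\<alpha> + \<beta>) + Q * R * (t - s) powr (\<alpha> + \<beta>) + ?F * \<eta> * (t - s) powr (\<alpha> + \<beta>)"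
      by (intro norm_triangle_le add_mono almost_additiveD[OF add(1) o] almost_additiveD[OF add(2) o] almost_additiveD[OF add(3) o])
    finally show "norm (?A s t - ?A s u - ?A u t) \<le> ?c * (t - s) powr (\<alpha> + \<beta>)"
      by (simp add: algebra_simps)
  qed
  moreover have "sewn (\<alpha> + \<beta>) (C + C') a b ?A (\<lambda>r. X r - Y r)"
    unfolding sewn_def A
  proof (intro allI impI)
    fix s t assume st: "a \<le> s" "s \<le> t" "t \<le> b"
    show "norm (X t - Y t - (X s - Y s) - (young_germ (\<lambda>r. \<sigma> r (w r) (x r)) g s t - young_germ (\<lambda>r. \<sigma> r (w' r) (y r)) g' s t))
       \<le> (C + C') * (t - s) powr (\<alpha> + \<beta>)"
      using norm_triangle_ineq4[of "X t - X s - young_germ (\<lambda>r. \<sigma> r (w r) (x r)) g s t"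
          "Y t - Y s - young_germ (\<lambda>r. \<sigma> r (w' r) (y r)) g' s t"] sewnD[OF X st] sewnD[OF Y st]
      by (simp add: algebra_simps)
  qed
  moreover have "norm (?A a b) \<le> (?P * R + Q * R + K * \<eta>) * (b - a) powr \<beta>"
  proof -
    have "norm (?A a b) \<le> ?P * R * (b - a) powr \<beta> + Q * R * (b - a) powr \<beta> + K * \<eta> * (b - a) powr \<beta>"
      using ab nn P K holder_ballD(2)[OF p, of a] holder_ballD(2)[OF q, of a] bounded
      by (intro norm_triangle_le add_mono young_germ_bound[OF _ g] young_germ_bound[OF _ gd]) (auto simp: f_def)
    then show ?thesis
      by (simp add: algebra_simps)
  qed
  ultimately have "norm ((X b - Y b) - (X a - Y a)) \<le> (sew * ?c + (?P * R + Q * R + K * \<eta>)) * (b - a) powr \<beta>"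
    using ab \<alpha> P F nn R \<eta> by (intro sewn_increment_bound[OF exponents_gt_1]) auto
  also have "\<dots> \<le> stability_rate B * (L + m + (Q + \<eta>)) * (b - a) powr \<beta>"
  proof (rule mult_right_mono)
    let ?S = "L + m + (Q + \<eta>)" and ?V = "(state_lip B + 1) * R + (?F + K)"
    have "?P * R \<le> state_lip B * ?S * R" "Q * R \<le> ?S * R" "?F * \<eta> \<le> ?F * ?S" "K * \<eta> \<le> K * ?S" "0 \<le> ?F * ?S" "0 \<le> K * ?S"
      using nn \<eta> L R K F state_lip_ge[of B] by (auto intro!: mult_right_mono mult_left_mono simp del: mult_le_cancel_left_pos)
    moreover have "?V * ?S = state_lip B * ?S * R + ?S * R + (?F * ?S + K * ?S)"
      by (simp add: algebra_simps)
    ultimately have "?c \<le> ?V * ?S" "?P * R + Q * R + K * \<eta> \<le> ?V * ?S"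
      by linarith+
    then have "sew * ?c + (?P * R + Q * R + K * \<eta>) \<le> sew * (?V * ?S) + ?V * ?S"
      by (intro add_mono mult_left_mono sew_nonneg)
    also have "\<dots> = stability_rate B * ?S"
      by (simp add: stability_rate_def algebra_simps)
    finally show "sew * ?c + (?P * R + Q * R + K * \<eta>) \<le> stability_rate B * ?S" .
  qed simp
  finally show ?thesis .
qed

section \<open>A priori bounds and stability\<close>

definition sewn_solution :: "(real \<Rightarrow> 'v) \<Rightarrow> (real \<Rightarrow> 'w) \<Rightarrow> real \<Rightarrow> real \<Rightarrow> (real \<Rightarrow> 'x) \<Rightarrow> bool" where
  "sewn_solution g w a b x \<longleftrightarrow>
     (\<exists>L\<ge>0. \<exists>C\<ge>0. holder_bound \<alpha> L a b x \<and> sewn (\<alpha> + \<beta>) C a b (young_germ (coefficient w x) g) x)"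

text \<open>
One direction needs that the coefficient along a Hoelder path is Hoelder, so that the integral is
approximated by its germ; the other is the convergence of Riemann sums of sewn paths.
\<close>

lemma yde_solution_iff_sewn_solution:
  assumes gw: "admissible g w" and ab: "0 \<le> a" "a < b" "b \<le> T"
  shows "yde_solution \<alpha> \<sigma> g w a b x0 x \<longleftrightarrow> x a = x0 \<and> sewn_solution g w a b x"
proof
  assume sol: "yde_solution \<alpha> \<sigma> g w a b x0 x"
  then have "x \<in> holder_space \<alpha> {a..b}"
    by (simp add: yde_solution_def)
  then obtain L where L: "0 < L" "holder_norm \<alpha> {a..b} x \<le> ennreal L"
    by (rule holder_spaceE)
  have x: "holder_ball \<alpha> L L a b x"
    using holder_norm_leD[OF L(2)] L(1) by (simp add: holder_ball_def)
  let ?H = "K * (L + (1 + 2 * L) * (R + 1))"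
  have H: "0 \<le> ?H"
    using L K R by simp
  have f: "holder_bound \<alpha> ?H a b (coefficient w x)"
    using ab L by (intro coefficient_holder_bound admissibleD[OF gw] x) auto
  have g: "holder_bound \<beta> R a b g"
    using ab by (intro admissibleD[OF gw]) auto
  have int: "\<exists>I. has_young_integral (coefficient w x) g a t I \<and> x t = x0 + I" if "t \<in> {a..b}" for t
    using sol that by (simp add: yde_solution_def)
  have "sewn (\<alpha> + \<beta>) (sewing_const (\<alpha> + \<beta>) * (?H * R)) a b (young_germ (coefficient w x) g) x" "x a = x0"
    using sewn_if_has_young_integral[OF f g H _ _ _ exponents_gt_1 ab(2) int] R \<alpha> by auto
  moreover have "0 \<le> sewing_const (\<alpha> + \<beta>) * (?H * R)"
    using H R sewing_const_pos[OF exponents_gt_1] by simp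
  ultimately show "x a = x0 \<and> sewn_solution g w a b x"
    using x L unfolding sewn_solution_def holder_ball_def by (blast intro: less_imp_le)
next
  assume "x a = x0 \<and> sewn_solution g w a b x"
  then obtain L C where *: "x a = x0" "0 \<le> L" "0 \<le> C" "holder_bound \<alpha> L a b x"
    "sewn (\<alpha> + \<beta>) C a b (young_germ (coefficient w x) g) x"
    by (auto simp: sewn_solution_def)
  have "x \<in> holder_space \<alpha> {a..b}"
    using holder_ball_if_bound[OF *(4,2) less_imp_le[OF \<alpha>_pos]] *(2,4)
    by (intro holder_spaceI[of L "norm (x a) + L * (b - a) powr \<alpha>"]) (auto simp: holder_ball_def)
  moreover have "\<exists>I. has_young_integral (coefficient w x) g a t I \<and> x t = x0 + I" if "t \<in> {a..b}" for t
    using that *(1) by (intro exI[of _ "x t - x a"] conjI has_young_integral_if_sewn[OF exponents_gt_1 *(3,5)]) auto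
  ultimately show "yde_solution \<alpha> \<sigma> g w a b x0 x"
    unfolding yde_solution_def by blast
qed

definition a_priori_const :: real where
  "a_priori_const = growth_const growth_rate \<alpha> \<beta> T"

lemma a_priori_const_nonneg: "0 \<le> a_priori_const"
  using growth_const_nonneg[OF growth_rate_nonneg] by (simp add: a_priori_const_def)

text \<open>
That \<open>x\<close> is Hoelder with some unspecified constant starts the iteration on short intervals; the limit of
the iteration, and with it \<open>B\<close>, has forgotten that constant.
\<close>

lemma a_priori_bound:
  assumes gw: "admissible g w" and ab: "0 \<le> a" "a \<le> b" "b \<le> T" and sol: "sewn_solution g w a b x"
  defines "B \<equiv> a_priori_const * (norm (x a) + 1)"
  shows "holder_ball \<alpha> B B a b x" "holder_bound \<beta> B a b x"
proof -
  obtain L\<^sub>0 C\<^sub>0 where x: "0 \<le> L\<^sub>0" "holder_bound \<alpha> L\<^sub>0 a b x"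
    "sewn (\<alpha> + \<beta>) C\<^sub>0 a b (young_germ (coefficient w x) g) x"
    using sol by (auto simp: sewn_solution_def)
  have "growth_controlled growth_rate 1 \<alpha> \<beta> a b x"
    unfolding growth_controlled_def
  proof (intro allI impI)
    fix s t L m assume *: "a \<le> s" "s \<le> t" "t \<le> b" "0 \<le> L" "0 \<le> m"
      "holder_bound \<alpha> L s t x" "\<forall>r\<in>{s..t}. norm (x r) \<le> m"
    show "norm (x t - x s) \<le> growth_rate * (L + m + 1) * (t - s) powr \<beta>"
      using * ab by (intro integral_growth[where g = g and w = w and x = x and C = C\<^sub>0] admissibleD[OF gw] sewn_subinterval[OF x(3)])
        (auto simp: holder_ball_def)
  qed
  note global = growth_controlled_global[OF \<alpha>_pos \<alpha>(2) growth_rate_nonneg _ ab(2) _ x(1,2) this, of T]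
  show "holder_ball \<alpha> B B a b x" "holder_bound \<beta> B a b x"
    using global ab by (auto simp: holder_ball_def B_def a_priori_const_def)
qed

definition stability_const :: "real \<Rightarrow> real" where
  "stability_const B = growth_const (stability_rate B) \<alpha> \<beta> T"

lemma stability_const_nonneg: "0 \<le> B \<Longrightarrow> 0 \<le> stability_const B"
  using growth_const_nonneg[OF stability_rate_nonneg] by (simp add: stability_const_def)

lemma stability:
  assumes gw: "admissible g w" "admissible g' w'" and ab: "0 \<le> a" "a \<le> b" "b \<le> T"
    and sol: "sewn_solution g w a b x" "sewn_solution g' w' a b y"
    and xB: "holder_ball \<alpha> B B a b x" and yB: "holder_ball \<alpha> B B a b y"
    and \<eta>: "0 \<le> \<eta>" and gd: "holder_bound \<beta> \<eta> a b (\<lambda>r. g r - g' r)"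
    and q: "holder_ball \<alpha> Q Q a b (\<lambda>r. \<sigma> r (w r) (y r) - \<sigma> r (w' r) (y r))"
  defines "C \<equiv> stability_const B * (norm (x a - y a) + (Q + \<eta>))"
  shows "holder_ball \<alpha> C C a b (\<lambda>r. x r - y r)"
proof -
  obtain C\<^sub>x C\<^sub>y where x: "sewn (\<alpha> + \<beta>) C\<^sub>x a b (young_germ (coefficient w x) g) x"
    and y: "sewn (\<alpha> + \<beta>) C\<^sub>y a b (young_germ (coefficient w' y) g') y"
    using sol by (auto simp: sewn_solution_def)
  have Q: "0 \<le> Q" and B: "0 \<le> B"
    using holder_ball_nonneg[OF q ab(2)] holder_ball_nonneg[OF xB ab(2)] .
  have z: "holder_bound \<alpha> (B + B) a b (\<lambda>r. x r - y r)"
    using holder_ball_diff[OF xB yB] by (simp add: holder_ball_def)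
  have ctrl: "growth_controlled (stability_rate B) (Q + \<eta>) \<alpha> \<beta> a b (\<lambda>r. x r - y r)"
    unfolding growth_controlled_def
  proof (intro allI impI)
    fix s t L m assume *: "a \<le> s" "s \<le> t" "t \<le> b" "0 \<le> L" "0 \<le> m"
      "holder_bound \<alpha> L s t (\<lambda>r. x r - y r)" "\<forall>r\<in>{s..t}. norm (x r - y r) \<le> m"
    have st: "0 \<le> s" "t \<le> T"
      using * ab by auto
    show "norm (x t - y t - (x s - y s)) \<le> stability_rate B * (L + m + (Q + \<eta>)) * (t - s) powr \<beta>"
      by (rule integral_difference_growth[OF st(1) *(2) st(2) admissibleD(1)[OF gw(1) st] admissibleD(1)[OF gw(2) st]
            holder_bound_mono[OF gd order_refl *(1,3)] \<eta> admissibleD(2)[OF gw(1) st] admissibleD(2)[OF gw(2) st]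
            holder_ball_subinterval[OF xB *(1,3)] holder_ball_subinterval[OF yB *(1,3)]
            holder_ball_subinterval[OF q *(1,3)] _ *(4) sewn_subinterval[OF x *(1,3)] sewn_subinterval[OF y *(1,3)]])
        (use * in \<open>auto simp: holder_ball_def\<close>)
  qed
  have "0 \<le> Q + \<eta>" "b - a \<le> T" "0 \<le> B + B"
    using Q \<eta> ab B by auto
  note global = growth_controlled_global[OF \<alpha>_pos \<alpha>(2) stability_rate_nonneg[OF B] this(1) ab(2) this(2,3) z ctrl]
  show "holder_ball \<alpha> C C a b (\<lambda>r. x r - y r)"
    using global by (auto simp: holder_ball_def C_def stability_const_def)
qed

text \<open>
Stability with identical data; both solutions lie in the same ball by the a priori bound.
\<close>

lemma sewn_solution_unique:
  assumes gw: "admissible g w" and ab: "0 \<le> a" "a \<le> b" "b \<le> T"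
    and x: "sewn_solution g w a b x" and y: "sewn_solution g w a b y" and eq: "x a = y a" and r: "r \<in> {a..b}"
  shows "x r = y r"
proof -
  define B where "B = a_priori_const * (norm (x a) + 1)"
  have xB: "holder_ball \<alpha> B B a b x" and yB: "holder_ball \<alpha> B B a b y"
    unfolding B_def using a_priori_bound(1)[OF gw ab x] a_priori_bound(1)[OF gw ab y] eq by auto
  let ?C = "stability_const B * (norm (x a - y a) + (0 + 0))"
  have "holder_ball \<alpha> ?C ?C a b (\<lambda>r. x r - y r)"
    by (rule stability[OF gw gw ab x y xB yB]) (auto simp: holder_ball_def holder_bound_def)
  then have "holder_ball \<alpha> 0 0 a b (\<lambda>r. x r - y r)"
    using eq by simp
  then show ?thesis
    using holder_ballD(2)[of \<alpha> 0 0 a b "\<lambda>r. x r - y r" r] r by simp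
qed

section \<open>Existence\<close>

lemma sewn_solution_concat:
  assumes gw: "admissible g w" and aub: "0 \<le> a" "a \<le> u" "u \<le> b" "b \<le> T"
    and x: "sewn_solution g w a u x" and y: "sewn_solution g w u b y" and eq: "x u = y u"
  shows "sewn_solution g w a b (\<lambda>r. if r \<le> u then x r else y r)"
proof -
  define z where "z = (\<lambda>r. if r \<le> u then x r else y r)"
  obtain L C where 1: "0 \<le> L" "0 \<le> C" "holder_bound \<alpha> L a u x" "sewn (\<alpha> + \<beta>) C a u (young_germ (coefficient w x) g) x"
    using x by (auto simp: sewn_solution_def)
  obtain L' C' where 2: "0 \<le> L'" "0 \<le> C'" "holder_bound \<alpha> L' u b y" "sewn (\<alpha> + \<beta>) C' u b (young_germ (coefficient w y) g) y"
    using y by (auto simp: sewn_solution_def)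
  have z_x: "z r = x r" if "r \<le> u" for r
    using that by (simp add: z_def)
  have z_y: "z r = y r" if "u \<le> r" for r
    using that eq by (auto simp: z_def)
  have z1: "holder_bound \<alpha> L a u z" "sewn (\<alpha> + \<beta>) C a u (young_germ (coefficient w z) g) z"
    using 1 z_x by (simp_all add: holder_bound_def sewn_def young_germ_def)
  have z2: "holder_bound \<alpha> L' u b z" "sewn (\<alpha> + \<beta>) C' u b (young_germ (coefficient w z) g) z"
    using 2 z_y by (simp_all add: holder_bound_def sewn_def young_germ_def)
  have H: "holder_bound \<alpha> (L + L') a b z"
    using 1 2 \<alpha> by (intro holder_bound_concat[OF z1(1) z2(1)]) auto
  obtain c where c: "0 \<le> c" "almost_additive (\<alpha> + \<beta>) c a b (young_germ (coefficient w z) g)"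
  proof
    let ?m = "norm (z a) + (L + L') * (b - a) powr \<alpha>"
    show "almost_additive (\<alpha> + \<beta>) (K * ((L + L') + (1 + 2 * ?m) * (R + 1)) * R) a b (young_germ (coefficient w z) g)"
      using aub 1 2 \<alpha>_pos by (intro coefficient_germ_almost_additive[OF gw] holder_ball_if_bound[OF H]) auto
    show "0 \<le> K * ((L + L') + (1 + 2 * ?m) * (R + 1)) * R"
      using K R 1 2 by (intro mult_nonneg_nonneg add_nonneg_nonneg) auto
  qed
  have "sewn (\<alpha> + \<beta>) (C + C' + c) a b (young_germ (coefficient w z) g) z"
    using 1 2 c exponents_gt_1 by (intro sewn_concat[OF z1(2) z2(2) c(2)]) auto
  then show ?thesis
    using H 1 2 c unfolding sewn_solution_def z_def[symmetric] by (meson add_nonneg_nonneg)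
qed

text \<open>
On a short interval the integral operator started at \<open>x0\<close> maps the ball of paths with Hoelder constant \<open>1\<close>
and bound \<open>B\<close> to itself: the higher order \<open>\<beta>\<close> of the integral beats the constant \<open>growth_rate * (B + 2)\<close>.
\<close>

lemma picard_step:
  assumes gw: "admissible g w" and ab: "0 \<le> a" "a < b" "b \<le> T" "b - a \<le> 1"
    and small: "growth_rate * (B + 2) * (b - a) powr (\<beta> - \<alpha>) \<le> 1" and B: "norm x0 + 1 \<le> B"
    and x: "holder_ball \<alpha> 1 B a b x"
  obtains y where "holder_ball \<alpha> 1 B a b y" "y a = x0"
    "sewn (\<alpha> + \<beta>) ((2 * sewing_const (\<alpha> + \<beta>) + 1) * (K * (1 + (1 + 2 * B) * (R + 1)) * R)) a b (young_germ (coefficient w x) g) y"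
proof -
  let ?c = "K * (1 + (1 + 2 * B) * (R + 1)) * R"
  let ?C = "(2 * sewing_const (\<alpha> + \<beta>) + 1) * ?c"
  have B0: "0 \<le> B"
    using B norm_ge_zero[of x0] by linarith
  have c: "0 \<le> ?c"
    using B0 K R by simp
  have A: "almost_additive (\<alpha> + \<beta>) ?c a b (young_germ (coefficient w x) g)"
    using ab by (intro coefficient_germ_almost_additive[OF gw _ _ _ x]) auto
  obtain Y where Y: "sewn (\<alpha> + \<beta>) ?C a b (young_germ (coefficient w x) g) Y"
    using sewing_exists[OF exponents_gt_1 c ab(2) A] .
  define y where "y r = x0 + (Y r - Y a)" for r
  have y: "sewn (\<alpha> + \<beta>) ?C a b (young_germ (coefficient w x) g) y"
    using Y by (simp add: sewn_def y_def)
  have hy: "holder_bound \<alpha> 1 a b y"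
    unfolding holder_bound_def
  proof (intro allI impI)
    fix s t assume st: "a \<le> s" "s \<le> t" "t \<le> b"
    have "norm (y t - y s) \<le> growth_rate * (1 + B + 1) * (t - s) powr \<beta>"
      using st ab by (intro integral_growth[where g = g and w = w and x = x and C = ?C] admissibleD[OF gw]
          sewn_subinterval[OF y] holder_ball_subinterval[OF x]) auto
    also have "\<dots> = growth_rate * (B + 2) * (t - s) powr (\<beta> - \<alpha>) * (t - s) powr \<alpha>"
      by (simp add: powr_diff)
    also have "\<dots> \<le> growth_rate * (B + 2) * (b - a) powr (\<beta> - \<alpha>) * (t - s) powr \<alpha>"
      using st \<alpha> growth_rate_nonneg B0 by (intro mult_right_mono mult_left_mono powr_mono2) auto
    also have "\<dots> \<le> 1 * (t - s) powr \<alpha>"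
      using small by (intro mult_right_mono) auto
    finally show "norm (y t - y s) \<le> 1 * (t - s) powr \<alpha>" .
  qed
  have "(b - a) powr \<alpha> \<le> 1"
    using ab \<alpha> by (intro powr_le1) auto
  then have "holder_ball \<alpha> 1 B a b y"
    using holder_ball_if_bound[OF hy zero_le_one less_imp_le[OF \<alpha>_pos]] B unfolding holder_ball_def by (force simp: y_def)
  then show ?thesis
    using y by (intro that[of y]) (auto simp: y_def)
qed

text \<open>
Chosen for paths in the ball of radius \<open>A + 1\<close>: the first summand keeps Picard iterates in the ball, the second makes
the iteration contract.
\<close>

definition picard_step_size :: "real \<Rightarrow> real" where
  "picard_step_size A = step_size (growth_rate * (A + 3) + stability_rate (A + 1)) (\<beta> - \<alpha>)"

lemma picard_step_size_pos: "0 \<le> A \<Longrightarrow> 0 < picard_step_size A"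
  unfolding picard_step_size_def
  by (intro step_size_bounds add_nonneg_nonneg mult_nonneg_nonneg growth_rate_nonneg stability_rate_nonneg) auto

text \<open>
Increments of Picard iterates contract in the Hoelder seminorm by \<open>integral_difference_growth\<close>, so the
iterates converge pointwise. The Hoelder bound and the sewing estimate hold with constants independent
of \<open>n\<close> and pass to the pointwise limit.
\<close>

lemma local_existence:
  assumes gw: "admissible g w" and ab: "0 \<le> a" "a < b" "b \<le> T" "b - a \<le> picard_step_size A" and x0: "norm x0 \<le> A"
  shows "\<exists>x. x a = x0 \<and> sewn_solution g w a b x"
proof -
  have A: "0 \<le> A"
    using norm_ge_zero x0 by (rule order_trans)
  define B where "B = A + 1"
  have B: "0 \<le> B"
    using A by (simp add: B_def)
  define \<kappa> where "\<kappa> = growth_rate * (B + 2) + stability_rate B"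
  have \<kappa>: "growth_rate * (B + 2) \<le> \<kappa>" "stability_rate B \<le> \<kappa>" "0 \<le> \<kappa>"
    using growth_rate_nonneg stability_rate_nonneg[OF B] B by (auto simp: \<kappa>_def)
  have h: "b - a \<le> step_size \<kappa> (\<beta> - \<alpha>)" "b - a \<le> 1"
    using ab(4) step_size_bounds(2)[of \<kappa> "\<beta> - \<alpha>"] by (auto simp: picard_step_size_def \<kappa>_def B_def add.assoc)
  have small: "\<kappa> * d powr (\<beta> - \<alpha>) \<le> 1/4" if "0 \<le> d" "d \<le> b - a" for d
    using that h step_size_small[OF \<kappa>(3), of "\<beta> - \<alpha>"] \<alpha> by simp
  let ?C = "(2 * sewing_const (\<alpha> + \<beta>) + 1) * (K * (1 + (1 + 2 * B) * (R + 1)) * R)"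
  have C: "0 \<le> ?C"
    using K R B sewing_const_pos[OF exponents_gt_1] by (intro mult_nonneg_nonneg add_nonneg_nonneg) auto
  have "growth_rate * (B + 2) * (b - a) powr (\<beta> - \<alpha>) \<le> \<kappa> * (b - a) powr (\<beta> - \<alpha>)"
    using \<kappa> by (intro mult_right_mono) auto
  then have small1: "growth_rate * (B + 2) * (b - a) powr (\<beta> - \<alpha>) \<le> 1"
    using small[of "b - a"] ab by linarith
  have "\<exists>X. \<forall>n. (holder_ball \<alpha> 1 B a b (X n) \<and> X n a = x0) \<and>
      sewn (\<alpha> + \<beta>) ?C a b (young_germ (coefficient w (X n)) g) (X (Suc n))"
  proof (rule dependent_nat_choice)
    show "\<exists>x. holder_ball \<alpha> 1 B a b x \<and> x a = x0"
      using x0 by (intro exI[of _ "\<lambda>_. x0"]) (auto simp: holder_ball_def holder_bound_def B_def)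
  next
    fix x :: "real \<Rightarrow> 'x"
    assume "holder_ball \<alpha> 1 B a b x \<and> x a = x0"
    then show "\<exists>y. (holder_ball \<alpha> 1 B a b y \<and> y a = x0) \<and> sewn (\<alpha> + \<beta>) ?C a b (young_germ (coefficient w x) g) y"
      using picard_step[OF gw ab(1-3) _ small1, of x0 x] ab h x0 by (auto simp: B_def)
  qed
  then obtain X where X: "\<And>n. holder_ball \<alpha> 1 B a b (X n)" "\<And>n. X n a = x0"
    "\<And>n. sewn (\<alpha> + \<beta>) ?C a b (young_germ (coefficient w (X n)) g) (X (Suc n))"
    by blast
  have XB: "holder_ball \<alpha> B B a b (X n)" for n
    using X(1)[of n] A holder_bound_mono[of \<alpha> 1 a b "X n" B a b] by (auto simp: holder_ball_def B_def)
  have contract: "holder_bound \<alpha> (2 * (1/2) ^ n) a b (\<lambda>r. X (Suc n) r - X n r)" for n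
  proof (induction n)
    case 0
    then show ?case
      using holder_ball_diff[OF X(1)[of "Suc 0"] X(1)[of 0]] by (simp add: holder_ball_def)
  next
    case (Suc n)
    let ?L = "2 * (1/2) ^ n :: real"
    \<comment> \<open>All iterates start at the same point, so the Hoelder constant also bounds the supremum.\<close>
    have "(b - a) powr \<alpha> \<le> 1"
      using ab h \<alpha> by (intro powr_le1) auto
    then have "?L * (b - a) powr \<alpha> \<le> ?L"
      by (simp add: mult_le_cancel_left1)
    moreover have "holder_ball \<alpha> ?L (?L * (b - a) powr \<alpha>) a b (\<lambda>r. X (Suc n) r - X n r)"
      using holder_ball_if_bound[OF Suc _ less_imp_le[OF \<alpha>_pos]] by (simp add: X(2))
    ultimately have z: "holder_ball \<alpha> ?L ?L a b (\<lambda>r. X (Suc n) r - X n r)"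
      unfolding holder_ball_def by (meson order_trans)
    show ?case
      unfolding holder_bound_def
    proof (intro allI impI)
      fix s t assume st: "a \<le> s" "s \<le> t" "t \<le> b"
      then have st': "0 \<le> s" "t \<le> T"
        using ab by auto
      have "norm ((X (Suc (Suc n)) t - X (Suc n) t) - (X (Suc (Suc n)) s - X (Suc n) s))
          \<le> stability_rate B * (?L + ?L + (0 + 0)) * (t - s) powr \<beta>"
        by (rule integral_difference_growth[OF st'(1) st(2) st'(2) admissibleD(1)[OF gw st'] admissibleD(1)[OF gw st']
            _ _ admissibleD(2)[OF gw st'] admissibleD(2)[OF gw st']
            holder_ball_subinterval[OF XB st(1,3)] holder_ball_subinterval[OF XB st(1,3)]
            _ holder_ball_subinterval[OF z st(1,3)] _ sewn_subinterval[OF X(3) st(1,3)] sewn_subinterval[OF X(3) st(1,3)]])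
          (auto simp: holder_ball_def holder_bound_def)
      also have "\<dots> = (stability_rate B * (t - s) powr (\<beta> - \<alpha>)) * (2 * ?L * (t - s) powr \<alpha>)"
        by (simp add: powr_diff)
      also have "\<dots> \<le> 1/4 * (2 * ?L * (t - s) powr \<alpha>)"
      proof (rule mult_right_mono)
        have "stability_rate B * (t - s) powr (\<beta> - \<alpha>) \<le> \<kappa> * (t - s) powr (\<beta> - \<alpha>)"
          using \<kappa> by (intro mult_right_mono) auto
        also have "\<dots> \<le> 1/4"
          using st ab by (intro small) auto
        finally show "stability_rate B * (t - s) powr (\<beta> - \<alpha>) \<le> 1/4" .
      qed simp
      finally show "norm ((X (Suc (Suc n)) t - X (Suc n) t) - (X (Suc (Suc n)) s - X (Suc n) s))
          \<le> 2 * (1/2) ^ Suc n * (t - s) powr \<alpha>"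
        by simp
    qed
  qed
  define x where "x r = lim (\<lambda>n. X n r)" for r
  have lim: "(\<lambda>n. X n r) \<longlonglongrightarrow> x r" if r: "a \<le> r" "r \<le> b" for r
  proof -
    have "norm (X (Suc n) r - X n r) \<le> 2 * (1/2) ^ n" for n
    proof -
      have "norm ((X (Suc n) r - X n r) - (X (Suc n) a - X n a)) \<le> 2 * (1/2) ^ n * (r - a) powr \<alpha>"
        using r by (intro holder_boundD[OF contract]) auto
      also have "\<dots> \<le> 2 * (1/2) ^ n * 1"
        using r ab h \<alpha> by (intro mult_left_mono powr_le1) auto
      finally show ?thesis
        by (simp add: X(2))
    qed
    then show ?thesis
      unfolding x_def convergent_LIMSEQ_iff[symmetric] by (intro convergent_geometric_increments[of "1/2" _ 2]) auto
  qed
  have "x a = x0"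
    using lim[of a] ab by (simp add: X(2) LIMSEQ_const_iff)
  moreover have "holder_bound \<alpha> 1 a b x"
    unfolding holder_bound_def
  proof (intro allI impI)
    fix s t assume st: "a \<le> s" "s \<le> t" "t \<le> b"
    have "(\<lambda>n. norm (X n t - X n s)) \<longlonglongrightarrow> norm (x t - x s)"
      using st by (intro tendsto_intros lim) auto
    then show "norm (x t - x s) \<le> 1 * (t - s) powr \<alpha>"
      using holder_ballD(1)[OF X(1) st] by (intro LIMSEQ_le_const2) auto
  qed
  moreover have "sewn (\<alpha> + \<beta>) ?C a b (young_germ (coefficient w x) g) x"
    unfolding sewn_def
  proof (intro allI impI)
    fix s t assume st: "a \<le> s" "s \<le> t" "t \<le> b"
    have "(\<lambda>n. \<sigma> s (w s) (X n s)) \<longlonglongrightarrow> \<sigma> s (w s) (x s)"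
      using st lim[of s] has_derivative_continuous[OF derivative] by (intro isCont_tendsto_compose[of _ "\<sigma> s (w s)"]) auto
    then have "(\<lambda>n. norm (X (Suc n) t - X (Suc n) s - young_germ (coefficient w (X n)) g s t))
        \<longlonglongrightarrow> norm (x t - x s - young_germ (coefficient w x) g s t)"
      unfolding young_germ_def using st by (intro tendsto_intros LIMSEQ_Suc lim) auto
    then show "norm (x t - x s - young_germ (coefficient w x) g s t) \<le> ?C * (t - s) powr (\<alpha> + \<beta>)"
      using sewnD[OF X(3) st] by (intro LIMSEQ_le_const2) auto
  qed
  ultimately show "\<exists>x. x a = x0 \<and> sewn_solution g w a b x"
    unfolding sewn_solution_def using C by (intro exI[of _ x] conjI exI[of _ 1] exI[of _ ?C]) auto
qed

text \<open>
The a priori bound keeps every restart value in one fixed ball, so a common step length can be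
used throughout.
\<close>

lemma sewn_solution_exists:
  assumes gw: "admissible g w" and ab: "0 \<le> a" "a \<le> b" "b \<le> T"
  shows "\<exists>x. x a = x0 \<and> sewn_solution g w a b x"
proof -
  let ?C = "a_priori_const"
  have A: "0 \<le> ?C * (norm x0 + 1)"
    using a_priori_const_nonneg by simp
  define h where "h = picard_step_size (?C * (norm x0 + 1))"
  have h: "0 < h"
    unfolding h_def by (rule picard_step_size_pos[OF A])
  have steps: "\<exists>x. x a = x0 \<and> sewn_solution g w a b x" if "a \<le> b" "b \<le> T" "b - a \<le> real n * h" for n b
    using that
  proof (induction n arbitrary: b)
    case 0
    then have "s = t" if "a \<le> s" "s \<le> t" "t \<le> b" for s t
      using that by simp
    then have "sewn_solution g w a b (\<lambda>_. x0)"
      unfolding sewn_solution_def holder_bound_def sewn_def young_germ_def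
      by (intro exI[of _ 0] conjI allI impI) force+
    then show ?case
      by auto
  next
    case (Suc n)
    show ?case
    proof (cases "b - a \<le> real n * h")
      case True
      then show ?thesis
        using Suc by blast
    next
      case False
      define u where "u = a + real n * h"
      have u: "a \<le> u" "u < b" "u \<le> T" "u - a \<le> real n * h" "b - u \<le> h"
        using False Suc.prems h by (auto simp: u_def algebra_simps)
      obtain x where x: "x a = x0" "sewn_solution g w a u x"
        using Suc.IH[OF u(1,3,4)] by blast
      have "norm (x u) \<le> ?C * (norm x0 + 1)"
        using holder_ballD(2)[OF a_priori_bound(1)[OF gw ab(1) u(1,3) x(2)], of u] u x by simp
      then obtain y where y: "y u = x u" "sewn_solution g w u b y"
        using local_existence[OF gw _ u(2) Suc.prems(2) u(5)[unfolded h_def], of "x u"] ab u by auto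
      have "sewn_solution g w a b (\<lambda>r. if r \<le> u then x r else y r)"
        using u Suc.prems ab y(1) by (intro sewn_solution_concat[OF gw _ _ _ _ x(2) y(2)]) auto
      then show ?thesis
        using u x(1) by (intro exI[of _ "\<lambda>r. if r \<le> u then x r else y r"]) auto
    qed
  qed
  have "b - a \<le> real (nat \<lceil>(b - a) / h\<rceil>) * h"
    using real_nat_ceiling_ge[of "(b - a) / h"] h by (simp add: field_simps)
  then show ?thesis
    using steps ab by blast
qed

section \<open>Well-posedness of the Young differential equation\<close>

lemma yde_solution_unique:
  assumes "admissible g w" "0 \<le> a" "a < b" "b \<le> T"
    and "yde_solution \<alpha> \<sigma> g w a b x0 x" "yde_solution \<alpha> \<sigma> g w a b x0 y" "t \<in> {a..b}"
  shows "y t = x t"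
  using assms yde_solution_iff_sewn_solution[OF assms(1-4)] sewn_solution_unique[OF assms(1,2) _ assms(4), of y x t] by auto

lemma yde_solution_exists:
  assumes "admissible g w" "0 \<le> a" "a < b" "b \<le> T"
  obtains x where "yde_solution \<alpha> \<sigma> g w a b x0 x"
  using sewn_solution_exists[OF assms(1,2) _ assms(4), of x0] assms(3) yde_solution_iff_sewn_solution[OF assms] by auto

lemma yde_flow_eq:
  assumes "admissible g w" "0 \<le> a" "a < T" "yde_solution \<alpha> \<sigma> g w a T x0 x" "t \<in> {a..T}"
  shows "yde_flow \<alpha> \<sigma> g w T x0 a t = x t"
  unfolding yde_flow_def
  using assms yde_solution_unique[OF assms(1-3) order_refl _ _ assms(5)] by (intro the_equality) blast+

definition solution_radius :: real where
  "solution_radius = a_priori_const * (R + 1)"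

lemma solution_radius_nonneg: "0 \<le> solution_radius"
  using a_priori_const_nonneg R by (simp add: solution_radius_def)

lemma yde_solution_bound:
  assumes gw: "admissible g w" and ab: "0 \<le> a" "a < b" "b \<le> T" and x0: "norm x0 \<le> R"
    and sol: "yde_solution \<alpha> \<sigma> g w a b x0 x"
  shows "sewn_solution g w a b x" "x a = x0"
    "holder_ball \<alpha> solution_radius solution_radius a b x" "holder_bound \<beta> solution_radius a b x"
proof -
  show x: "sewn_solution g w a b x" "x a = x0"
    using sol yde_solution_iff_sewn_solution[OF gw ab] by auto
  have "a_priori_const * (norm (x a) + 1) \<le> solution_radius"
    unfolding solution_radius_def using x0 x a_priori_const_nonneg by (intro mult_left_mono) auto
  then show "holder_ball \<alpha> solution_radius solution_radius a b x" "holder_bound \<beta> solution_radius a b x"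
    using a_priori_bound[OF gw ab(1) less_imp_le[OF ab(2)] ab(3) x(1)]
    by (auto simp: holder_ball_def intro: holder_bound_mono order_trans)
qed

text \<open>
The second bound trades the excess \<open>\<beta> - \<alpha>\<close> in the order of the solution for a power of the length of the interval.
\<close>

lemma yde_flow_bounds:
  assumes gw: "admissible g w" and ab: "0 \<le> a" "a < b" "b \<le> T" and x0: "norm x0 \<le> R"
  shows "holder_norm \<alpha> {a..T} (yde_flow \<alpha> \<sigma> g w T x0 a) \<le> ennreal (2 * solution_radius)"
    and "holder_seminorm \<alpha> {a..b} (yde_flow \<alpha> \<sigma> g w T x0 a) \<le> ennreal (solution_radius * \<bar>b - a\<bar> powr (\<beta> - \<alpha>))"
proof -
  let ?f = "yde_flow \<alpha> \<sigma> g w T x0 a"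
  have aT: "a < T"
    using ab by simp
  obtain x where x: "yde_solution \<alpha> \<sigma> g w a T x0 x"
    using yde_solution_exists[OF gw ab(1) aT order_refl] .
  have eq: "?f t = x t" if "a \<le> t" "t \<le> T" for t
    using yde_flow_eq[OF gw ab(1) aT x] that by simp
  note bounds = yde_solution_bound(3,4)[OF gw ab(1) aT order_refl x0 x]
  have f: "holder_ball \<alpha> solution_radius solution_radius a T ?f" "holder_bound \<beta> solution_radius a T ?f"
    using bounds eq by (auto simp: holder_ball_def holder_bound_def)
  then show "holder_norm \<alpha> {a..T} ?f \<le> ennreal (2 * solution_radius)"
    using holder_norm_leI[OF solution_radius_nonneg solution_radius_nonneg, of \<alpha> a T ?f] by (simp add: holder_ball_def)
  have "holder_bound \<alpha> (solution_radius * \<bar>b - a\<bar> powr (\<beta> - \<alpha>)) a b ?f"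
    unfolding holder_bound_def
  proof (intro allI impI)
    fix s t assume st: "a \<le> s" "s \<le> t" "t \<le> b"
    have "norm (?f t - ?f s) \<le> solution_radius * (t - s) powr \<beta>"
      using st ab by (intro holder_boundD[OF f(2)]) auto
    also have "\<dots> = solution_radius * (t - s) powr (\<beta> - \<alpha>) * (t - s) powr \<alpha>"
      by (simp add: powr_diff)
    also have "\<dots> \<le> solution_radius * \<bar>b - a\<bar> powr (\<beta> - \<alpha>) * (t - s) powr \<alpha>"
      using st \<alpha> solution_radius_nonneg by (intro mult_right_mono mult_left_mono powr_mono2) auto
    finally show "norm (?f t - ?f s) \<le> solution_radius * \<bar>b - a\<bar> powr (\<beta> - \<alpha>) * (t - s) powr \<alpha>" .
  qed
  then show "holder_seminorm \<alpha> {a..b} ?f \<le> ennreal (solution_radius * \<bar>b - a\<bar> powr (\<beta> - \<alpha>))"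
    using solution_radius_nonneg by (intro holder_seminorm_le_iff[THEN iffD2]) auto
qed

lemma yde_stability:
  assumes gw: "admissible g w" "admissible g' w'" and ab: "0 \<le> a" "a < b" "b \<le> T"
    and init: "norm x0 \<le> R" "norm y0 \<le> R"
    and sol: "yde_solution \<alpha> \<sigma> g w a b x0 x" "yde_solution \<alpha> \<sigma> g' w' a b y0 y"
    and \<eta>: "0 \<le> \<eta>" and gd: "holder_bound \<beta> \<eta> a b (\<lambda>r. g r - g' r)"
    and q: "holder_ball \<alpha> Q Q a b (\<lambda>r. \<sigma> r (w r) (y r) - \<sigma> r (w' r) (y r))"
  shows "holder_norm \<alpha> {a..b} (\<lambda>t. x t - y t)
     \<le> ennreal (2 * stability_const solution_radius * (norm (x0 - y0) + (Q + \<eta>)))"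
proof -
  let ?C = "stability_const solution_radius * (norm (x0 - y0) + (Q + \<eta>))"
  note x = yde_solution_bound[OF gw(1) ab init(1) sol(1)] and y = yde_solution_bound[OF gw(2) ab init(2) sol(2)]
  have "holder_ball \<alpha> ?C ?C a b (\<lambda>t. x t - y t)"
    using stability[OF gw ab(1) less_imp_le[OF ab(2)] ab(3) x(1) y(1) x(3) y(3) \<eta> gd q] by (simp add: x(2) y(2))
  moreover have "0 \<le> ?C"
    using stability_const_nonneg[OF solution_radius_nonneg] \<eta> holder_ball_nonneg[OF q] ab by simp
  ultimately have "holder_norm \<alpha> {a..b} (\<lambda>t. x t - y t) \<le> ennreal (?C + ?C)"
    by (intro holder_norm_leI) (auto simp: holder_ball_def)
  then show ?thesis
    by (simp add: algebra_simps)
qed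

end

theorem theorem4p6:
  fixes T \<alpha> \<beta> :: real
    and \<sigma> :: "real \<Rightarrow> 'w::banach \<Rightarrow> 'x::banach \<Rightarrow> ('v::banach \<Rightarrow>\<^sub>L 'x)"
  assumes "T > 0"
    and "1/2 < \<beta>" and "\<beta> \<le> 1"
    and "1/2 < \<alpha>" and "\<alpha> < \<beta>"
    and "nice_function \<alpha> \<sigma>"
  shows
    "(\<forall>g \<in> holder_space \<beta> {0..T}. \<forall>w \<in> holder_space \<alpha> {0..T}. \<forall>t0 t1 a.
        0 \<le> t0 \<and> t0 < t1 \<and> t1 \<le> T \<longrightarrow>
        (\<exists>x. yde_solution \<alpha> \<sigma> g w t0 t1 a x \<and>
             (\<forall>y. yde_solution \<alpha> \<sigma> g w t0 t1 a y \<longrightarrow> (\<forall>t\<in>{t0..t1}. y t = x t)))) \<and>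
     (\<forall>R>0. \<exists>C_flow>0. \<exists>C_loc>0. \<exists>C_init>0. \<exists>C_driver>0. \<exists>C_param>0.
        \<forall>a \<in> cball 0 R. \<forall>b \<in> cball 0 R.
        \<forall>g \<in> holder_space \<beta> {0..T}. \<forall>g' \<in> holder_space \<beta> {0..T}.
        \<forall>w \<in> holder_space \<alpha> {0..T}. \<forall>w' \<in> holder_space \<alpha> {0..T}. \<forall>t0 t1.
          holder_seminorm \<beta> {0..T} g \<le> ennreal R \<and> holder_seminorm \<beta> {0..T} g' \<le> ennreal R \<and>
          holder_norm \<alpha> {0..T} w \<le> ennreal R \<and> holder_norm \<alpha> {0..T} w' \<le> ennreal R \<and>
          0 \<le> t0 \<and> t0 < t1 \<and> t1 \<le> T \<longrightarrow>
          holder_norm \<alpha> {t0..T} (yde_flow \<alpha> \<sigma> g w T a t0) \<le> ennreal C_flow \<and>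
          holder_seminorm \<alpha> {t0..t1} (yde_flow \<alpha> \<sigma> g w T a t0)
            \<le> ennreal (C_loc * \<bar>t1 - t0\<bar> powr (\<beta> - \<alpha>)) \<and>
          (\<forall>x y. yde_solution \<alpha> \<sigma> g w t0 t1 a x \<and> yde_solution \<alpha> \<sigma> g w t0 t1 b y \<longrightarrow>
             holder_norm \<alpha> {t0..t1} (\<lambda>t. x t - y t) \<le> ennreal (C_init * norm (a - b))) \<and>
          (\<forall>x y. yde_solution \<alpha> \<sigma> g w t0 t1 a x \<and> yde_solution \<alpha> \<sigma> g' w t0 t1 a y \<longrightarrow>
             holder_norm \<alpha> {t0..t1} (\<lambda>t. x t - y t)
               \<le> ennreal C_driver * holder_seminorm \<beta> {0..T} (\<lambda>t. g t - g' t)) \<and>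
          (nice_in_param \<alpha> \<sigma> \<longrightarrow>
             (\<forall>x y. yde_solution \<alpha> \<sigma> g w t0 t1 a x \<and> yde_solution \<alpha> \<sigma> g w' t0 t1 a y \<longrightarrow>
                holder_norm \<alpha> {t0..t1} (\<lambda>t. x t - y t)
                  \<le> ennreal C_param * holder_norm \<alpha> {0..T} (\<lambda>t. w t - w' t))))"
proof (rule conjI)
  note coefficient = young_coefficient_if_nice[OF assms(6,1,4,5)]
  show "\<forall>g \<in> holder_space \<beta> {0..T}. \<forall>w \<in> holder_space \<alpha> {0..T}. \<forall>t0 t1 a.
        0 \<le> t0 \<and> t0 < t1 \<and> t1 \<le> T \<longrightarrow>
        (\<exists>x. yde_solution \<alpha> \<sigma> g w t0 t1 a x \<and>
             (\<forall>y. yde_solution \<alpha> \<sigma> g w t0 t1 a y \<longrightarrow> (\<forall>t\<in>{t0..t1}. y t = x t)))"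
  proof (intro ballI allI impI, elim conjE)
    fix g :: "real \<Rightarrow> 'v" and w :: "real \<Rightarrow> 'w" and t0 t1 and a :: 'x
    assume g: "g \<in> holder_space \<beta> {0..T}" and w: "w \<in> holder_space \<alpha> {0..T}" and t: "0 \<le> t0" "t0 < t1" "t1 \<le> T"
    obtain G where G: "0 \<le> G" "holder_seminorm \<beta> {0..T} g = ennreal G"
      using holder_seminorm_eq_ennreal[OF g] .
    obtain W where W: "0 \<le> W" "holder_norm \<alpha> {0..T} w = ennreal W"
      using holder_norm_eq_ennreal[OF w] .
    \<comment> \<open>Existence and uniqueness hold for arbitrary data; the radius is chosen to fit the given ones.\<close>
    let ?R = "max 1 (max G W)"
    have R: "0 < ?R"
      by (simp add: less_max_iff_disj)
    obtain D K where "young_coefficient \<sigma> D \<alpha> \<beta> T ?R K"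
      using coefficient[OF R] .
    then interpret young_coefficient \<sigma> D \<alpha> \<beta> T ?R K .
    have gw: "admissible g w"
      using G W by (intro admissibleI) (auto intro!: ennreal_leI)
    obtain x where "yde_solution \<alpha> \<sigma> g w t0 t1 a x"
      using yde_solution_exists[OF gw t] .
    then show "\<exists>x. yde_solution \<alpha> \<sigma> g w t0 t1 a x \<and>
        (\<forall>y. yde_solution \<alpha> \<sigma> g w t0 t1 a y \<longrightarrow> (\<forall>t\<in>{t0..t1}. y t = x t))"
      using yde_solution_unique[OF gw t] by blast
  qed
  show "\<forall>R>0. \<exists>C_flow>0. \<exists>C_loc>0. \<exists>C_init>0. \<exists>C_driver>0. \<exists>C_param>0.
        \<forall>a \<in> cball 0 R. \<forall>b \<in> cball 0 R.
        \<forall>g \<in> holder_space \<beta> {0..T}. \<forall>g' \<in> holder_space \<beta> {0..T}.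
        \<forall>w \<in> holder_space \<alpha> {0..T}. \<forall>w' \<in> holder_space \<alpha> {0..T}. \<forall>t0 t1.
          holder_seminorm \<beta> {0..T} g \<le> ennreal R \<and> holder_seminorm \<beta> {0..T} g' \<le> ennreal R \<and>
          holder_norm \<alpha> {0..T} w \<le> ennreal R \<and> holder_norm \<alpha> {0..T} w' \<le> ennreal R \<and>
          0 \<le> t0 \<and> t0 < t1 \<and> t1 \<le> T \<longrightarrow>
          holder_norm \<alpha> {t0..T} (yde_flow \<alpha> \<sigma> g w T a t0) \<le> ennreal C_flow \<and>
          holder_seminorm \<alpha> {t0..t1} (yde_flow \<alpha> \<sigma> g w T a t0)
            \<le> ennreal (C_loc * \<bar>t1 - t0\<bar> powr (\<beta> - \<alpha>)) \<and>
          (\<forall>x y. yde_solution \<alpha> \<sigma> g w t0 t1 a x \<and> yde_solution \<alpha> \<sigma> g w t0 t1 b y \<longrightarrow>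
             holder_norm \<alpha> {t0..t1} (\<lambda>t. x t - y t) \<le> ennreal (C_init * norm (a - b))) \<and>
          (\<forall>x y. yde_solution \<alpha> \<sigma> g w t0 t1 a x \<and> yde_solution \<alpha> \<sigma> g' w t0 t1 a y \<longrightarrow>
             holder_norm \<alpha> {t0..t1} (\<lambda>t. x t - y t)
               \<le> ennreal C_driver * holder_seminorm \<beta> {0..T} (\<lambda>t. g t - g' t)) \<and>
          (nice_in_param \<alpha> \<sigma> \<longrightarrow>
             (\<forall>x y. yde_solution \<alpha> \<sigma> g w t0 t1 a x \<and> yde_solution \<alpha> \<sigma> g w' t0 t1 a y \<longrightarrow>
                holder_norm \<alpha> {t0..t1} (\<lambda>t. x t - y t)
                  \<le> ennreal C_param * holder_norm \<alpha> {0..T} (\<lambda>t. w t - w' t)))"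
    (is "\<forall>R>0. ?constants R")
  proof (intro allI impI)
    fix R :: real assume R: "0 < R"
    obtain D K where "young_coefficient \<sigma> D \<alpha> \<beta> T R K"
      using coefficient[OF R] .
    then interpret young_coefficient \<sigma> D \<alpha> \<beta> T R K .
    let ?B = solution_radius
    define C where "C = 2 * stability_const ?B"
    have C: "0 \<le> C"
      using stability_const_nonneg[OF solution_radius_nonneg] by (simp add: C_def)
    obtain P where P: "0 \<le> P" and param: "nice_in_param \<alpha> \<sigma> \<Longrightarrow> \<forall>w w' y N a b. 0 \<le> a \<longrightarrow> a \<le> b \<longrightarrow> b \<le> T \<longrightarrow>
       holder_ball \<alpha> R R a b w \<longrightarrow> holder_ball \<alpha> R R a b w' \<longrightarrow> holder_ball \<alpha> ?B ?B a b y \<longrightarrow>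
       holder_ball \<alpha> N N a b (\<lambda>r. w r - w' r) \<longrightarrow>
       holder_ball \<alpha> (P * N) (P * N) a b (\<lambda>r. \<sigma> r (w r) (y r) - \<sigma> r (w' r) (y r))"
    proof (cases "nice_in_param \<alpha> \<sigma>")
      case True
      then show ?thesis
        by (rule param_difference_const[OF solution_radius_nonneg]) (rule that)
    next
      case False
      then show ?thesis
        using that[of 0] by simp
    qed
    have flat: "holder_bound \<beta> 0 t0 t1 (\<lambda>r. g r - g r)" for g :: "real \<Rightarrow> 'v" and t0 t1
      by (simp add: holder_bound_def)
    have no_param: "holder_ball \<alpha> 0 0 t0 t1 (\<lambda>r. \<sigma> r (w r) (y r) - \<sigma> r (w r) (y r))" for w y t0 t1
      by (simp add: holder_ball_def holder_bound_def)
    \<comment> \<open>The constants are required to be positive, whence the additional \<open>1\<close>.\<close>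
    have enlarge: "ennreal (c * N) \<le> ennreal (c + 1) * ennreal N" if "0 \<le> c" "0 \<le> N" for c N
      unfolding ennreal_mult[symmetric, OF add_nonneg_nonneg[OF that(1) zero_le_one] that(2)]
      using that by (intro ennreal_leI) (simp add: algebra_simps)
    show "?constants R"
    proof (rule exI[of _ "2 * ?B + 1"], rule conjI, use solution_radius_nonneg in simp,
        rule exI[of _ "?B + 1"], rule conjI, use solution_radius_nonneg in simp,
        rule exI[of _ "C + 1"], rule conjI, use C in simp, rule exI[of _ "C + 1"], rule conjI, use C in simp,
        rule exI[of _ "C * P + 1"], rule conjI, use C P in \<open>simp add: add_nonneg_pos\<close>,
        intro ballI allI impI, elim conjE)
      fix a b :: 'x and g g' :: "real \<Rightarrow> 'v" and w w' :: "real \<Rightarrow> 'w" and t0 t1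
      assume a: "a \<in> cball 0 R" and b: "b \<in> cball 0 R"
        and g_space: "g \<in> holder_space \<beta> {0..T}" "g' \<in> holder_space \<beta> {0..T}"
        and w_space: "w \<in> holder_space \<alpha> {0..T}" "w' \<in> holder_space \<alpha> {0..T}"
        and g: "holder_seminorm \<beta> {0..T} g \<le> ennreal R" "holder_seminorm \<beta> {0..T} g' \<le> ennreal R"
        and w: "holder_norm \<alpha> {0..T} w \<le> ennreal R" "holder_norm \<alpha> {0..T} w' \<le> ennreal R"
        and t: "0 \<le> t0" "t0 < t1" "t1 \<le> T"
      have norms: "norm a \<le> R" "norm b \<le> R"
        using a b by auto
      have gw: "admissible g w" and g'w: "admissible g' w" and gw': "admissible g w'"
        using g w by (auto intro: admissibleI)
      show "holder_norm \<alpha> {t0..T} (yde_flow \<alpha> \<sigma> g w T a t0) \<le> ennreal (2 * ?B + 1) \<and>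
          holder_seminorm \<alpha> {t0..t1} (yde_flow \<alpha> \<sigma> g w T a t0)
            \<le> ennreal ((?B + 1) * \<bar>t1 - t0\<bar> powr (\<beta> - \<alpha>)) \<and>
          (\<forall>x y. yde_solution \<alpha> \<sigma> g w t0 t1 a x \<and> yde_solution \<alpha> \<sigma> g w t0 t1 b y \<longrightarrow>
             holder_norm \<alpha> {t0..t1} (\<lambda>t. x t - y t) \<le> ennreal ((C + 1) * norm (a - b))) \<and>
          (\<forall>x y. yde_solution \<alpha> \<sigma> g w t0 t1 a x \<and> yde_solution \<alpha> \<sigma> g' w t0 t1 a y \<longrightarrow>
             holder_norm \<alpha> {t0..t1} (\<lambda>t. x t - y t)
               \<le> ennreal (C + 1) * holder_seminorm \<beta> {0..T} (\<lambda>t. g t - g' t)) \<and>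
          (nice_in_param \<alpha> \<sigma> \<longrightarrow>
             (\<forall>x y. yde_solution \<alpha> \<sigma> g w t0 t1 a x \<and> yde_solution \<alpha> \<sigma> g w' t0 t1 a y \<longrightarrow>
                holder_norm \<alpha> {t0..t1} (\<lambda>t. x t - y t)
                  \<le> ennreal (C * P + 1) * holder_norm \<alpha> {0..T} (\<lambda>t. w t - w' t)))"
      proof (intro conjI allI impI; (elim conjE)?)
        show "holder_norm \<alpha> {t0..T} (yde_flow \<alpha> \<sigma> g w T a t0) \<le> ennreal (2 * ?B + 1)"
          by (rule order_trans[OF yde_flow_bounds(1)[OF gw t norms(1)]]) (simp add: ennreal_leI)
        show "holder_seminorm \<alpha> {t0..t1} (yde_flow \<alpha> \<sigma> g w T a t0)
            \<le> ennreal ((?B + 1) * \<bar>t1 - t0\<bar> powr (\<beta> - \<alpha>))"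
          by (rule order_trans[OF yde_flow_bounds(2)[OF gw t norms(1)]]) (intro ennreal_leI mult_right_mono, auto)
      next
        fix x y assume sol: "yde_solution \<alpha> \<sigma> g w t0 t1 a x" "yde_solution \<alpha> \<sigma> g w t0 t1 b y"
        have "holder_norm \<alpha> {t0..t1} (\<lambda>t. x t - y t) \<le> ennreal (C * (norm (a - b) + (0 + 0)))"
          unfolding C_def by (rule yde_stability[OF gw gw t norms sol order_refl flat no_param])
        also have "\<dots> \<le> ennreal ((C + 1) * norm (a - b))"
          by (intro ennreal_leI) (simp add: algebra_simps)
        finally show "holder_norm \<alpha> {t0..t1} (\<lambda>t. x t - y t) \<le> ennreal ((C + 1) * norm (a - b))" .
      next
        fix x y assume sol: "yde_solution \<alpha> \<sigma> g w t0 t1 a x" "yde_solution \<alpha> \<sigma> g' w t0 t1 a y"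
        obtain \<eta> where \<eta>: "0 \<le> \<eta>" "holder_seminorm \<beta> {0..T} (\<lambda>t. g t - g' t) = ennreal \<eta>"
          using holder_seminorm_eq_ennreal[OF holder_space_diff[OF g_space]] .
        have "holder_bound \<beta> \<eta> 0 T (\<lambda>t. g t - g' t)"
          using \<eta> by (simp flip: holder_seminorm_le_iff)
        then have "holder_bound \<beta> \<eta> t0 t1 (\<lambda>t. g t - g' t)"
          by (rule holder_bound_mono[OF _ order_refl t(1,3)])
        then have "holder_norm \<alpha> {t0..t1} (\<lambda>t. x t - y t) \<le> ennreal (C * (norm (a - a) + (0 + \<eta>)))"
          unfolding C_def by (rule yde_stability[OF gw g'w t norms(1,1) sol \<eta>(1) _ no_param])
        also have "\<dots> \<le> ennreal (C + 1) * ennreal \<eta>"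
          using enlarge[OF C \<eta>(1)] by simp
        finally show "holder_norm \<alpha> {t0..t1} (\<lambda>t. x t - y t)
            \<le> ennreal (C + 1) * holder_seminorm \<beta> {0..T} (\<lambda>t. g t - g' t)"
          by (simp only: \<eta>(2))
      next
        fix x y assume nice: "nice_in_param \<alpha> \<sigma>"
          and sol: "yde_solution \<alpha> \<sigma> g w t0 t1 a x" "yde_solution \<alpha> \<sigma> g w' t0 t1 a y"
        obtain N where N: "0 \<le> N" "holder_norm \<alpha> {0..T} (\<lambda>t. w t - w' t) = ennreal N"
          using holder_norm_eq_ennreal[OF holder_space_diff[OF w_space]] .
        have "holder_ball \<alpha> N N 0 T (\<lambda>t. w t - w' t)"
          using holder_norm_leD[of \<alpha> 0 T "\<lambda>t. w t - w' t" N] N by (simp add: holder_ball_def)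
        then have "holder_ball \<alpha> N N t0 t1 (\<lambda>t. w t - w' t)"
          by (rule holder_ball_subinterval[OF _ t(1,3)])
        then have "holder_ball \<alpha> (P * N) (P * N) t0 t1 (\<lambda>r. \<sigma> r (w r) (y r) - \<sigma> r (w' r) (y r))"
          by (rule param[OF nice, rule_format, OF t(1) less_imp_le[OF t(2)] t(3) admissibleD(2)[OF gw t(1,3)]
                admissibleD(2)[OF gw' t(1,3)] yde_solution_bound(3)[OF gw' t norms(1) sol(2)]])
        then have "holder_norm \<alpha> {t0..t1} (\<lambda>t. x t - y t) \<le> ennreal (C * (norm (a - a) + (P * N + 0)))"
          unfolding C_def by (rule yde_stability[OF gw gw' t norms(1,1) sol order_refl flat])
        also have "\<dots> \<le> ennreal (C * P + 1) * ennreal N"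
          using enlarge[OF mult_nonneg_nonneg[OF C P] N(1)] by (simp add: mult.assoc)
        finally show "holder_norm \<alpha> {t0..t1} (\<lambda>t. x t - y t)
            \<le> ennreal (C * P + 1) * holder_norm \<alpha> {0..T} (\<lambda>t. w t - w' t)"
          by (simp only: N(2))
      qed
    qed
  qed
qed

end
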